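(* Let $\mathbf d=(n,2,m)$ with $n\ge2$, and $\sigma(x)=1/x$. Then the ideal of the rational neural network with architecture $(\mathbf d,\sigma)$ (the vanishing ideal of its neurovariety, in the polynomial ring in the variables $C_{k,\mathbf e_i}$ and $C_{\mathbf e_i+\mathbf e_j}$ described in the context) is generated by all $3\times3$ minors of the $n\times(m+n)$ matrix $$\mathbf M=\begin{pmatrix} C_{1,\mathbf e_1}&\cdots&C_{m,\mathbf e_1}&2C_{2\mathbf e_1}&C_{\mathbf e_1+\mathbf e_2}&\cdots&C_{\mathbf e_1+\mathbf e_n}\\ C_{1,\mathbf e_2}&\cdots&C_{m,\mathbf e_2}&C_{\mathbf e_1+\mathbf e_2}&2C_{2\mathbf e_2}&\cdots&C_{\mathbf e_2+\mathbf e_n}\\ \vdots&&\vdots&\vdots&\vdots&\ddots&\vdots\\ C_{1,\mathbf e_n}&\cdots&C_{m,\mathbf e_n}&C_{\mathbf e_1+\mathbf e_n}&C_{\mathbf e_2+\mathbf e_n}&\cdots&2C_{2\mathbf e_n} \end{pmatrix},$$ that is, the rows are indexed by $i=1,\dots,n$, the entry in row $i$ of the $k$-th column ($1\le k\le m$) is $C_{k,\mathbf e_i}$, and the entry in row $i$ of the $(m+j)$-th column ($1\le j\le n$) is $C_{\mathbf e_i+\mathbf e_j}$ if $i\ne j$ and $2C_{2\mathbf e_i}$ if $i=j$. The dimension of this ideal is $2(n+m)-1$.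
   Context: For weights $W_1=(a_{ij})\in\mathbb R^{2\times n}$ and $W_2=(b_{ki})\in\mathbb R^{m\times2}$, the network $W_2\circ\sigma\circ W_1$ ($\sigma$ entrywise) has the form $$\left(\frac{\sum_{i}C_{k,\mathbf e_i}x_i}{\sum_{1\le i\le j\le n}C_{\mathbf e_i+\mathbf e_j}x_ix_j}\right)_{k=1,\dots,m},$$ where $C_{2\mathbf e_i}=a_{1i}a_{2i}$, $C_{\mathbf e_i+\mathbf e_j}=a_{1i}a_{2j}+a_{1j}a_{2i}$ for $i\neq j$, and $C_{k,\mathbf e_i}=b_{k1}a_{2i}+b_{k2}a_{1i}$ (i.e. the denominator is $\ell_1\ell_2$ and the $k$-th numerator is $b_{k1}\ell_2+b_{k2}\ell_1$ with $\ell_j=(W_1\mathbf x)_j$). Here $\mathbf e_i$ is the $i$-th unit vector of length $n$. The neuromanifold is the image of the polynomial map sending $(W_1,W_2)$ to these coefficients, in $(S^1(\mathbb R^n))^m\times S^2(\mathbb R^n)$ ($S^d(\mathbb R^n)$ = homogeneous polynomials of degree $d$ in $n$ variables), and the neurovariety is its Zariski closure. Equivalently, the ideal of the network is the kernel of the ring homomorphism $\phi:\mathbb R[C]\to\mathbb R[a,b]$ given by $C_{2\mathbf e_i}\mapsto a_{1i}a_{2i}$ for $1\le i\le n$, $C_{\mathbf e_i+\mathbf e_j}\mapsto a_{1i}a_{2j}+a_{1j}a_{2i}$ for $1\le i<j\le n$, and $C_{k,\mathbf e_i}\mapsto b_{k1}a_{2i}+b_{k2}a_{1i}$ for $1\le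 k\le m$, $1\le i\le n$, where $\mathbb R[C]$ is the polynomial ring in the variables $C_{k,\mathbf e_i}$ ($1\le k\le m$, $1\le i\le n$) and $C_{\mathbf e_i+\mathbf e_j}$ ($1\le i\le j\le n$), and $\mathbb R[a,b]$ is the polynomial ring in the entries $a_{ij}$ of $W_1$ and $b_{ki}$ of $W_2$, regarded as variables. The dimension of an ideal is the Krull dimension of the quotient ring. *)

theory Defs
  imports
    "HOL-Analysis.Analysis"
    "HOL-Library.Uprod"
    "HOL-Library.Poly_Mapping"
    "HOL-Library.Extended_Nat"
    "HOL-Algebra.QuotRing"
    "HOL-Algebra.Algebraic_Closure_Type"
begin

unbundle no fps_syntax

section \<open>Polynomials, algebraic sets and Krull dimension\<close>

text \<open>Finitely supported exponent vectors are monomials, and finitely supported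
  real-valued functions on monomials, with convolution as product, are polynomials.\<close>

type_synonym 'v rpoly = "('v \<Rightarrow>\<^sub>0 nat) \<Rightarrow>\<^sub>0 real"

definition pvar :: "'v \<Rightarrow> 'v rpoly" where
  "pvar v = Poly_Mapping.single (Poly_Mapping.single v 1) 1"

definition peval :: "('v \<Rightarrow> real) \<Rightarrow> 'v rpoly \<Rightarrow> real" where
  "peval x p = (\<Sum>t\<in>Poly_Mapping.keys p. Poly_Mapping.lookup p t *
      (\<Prod>v\<in>Poly_Mapping.keys t. x v ^ Poly_Mapping.lookup t v))"

abbreviation rpoly_ring :: "'v rpoly ring" where
  "rpoly_ring \<equiv> ring_of_type_algebra"

definition algebraic_set :: "('v \<Rightarrow> real) set \<Rightarrow> bool" where
  "algebraic_set V \<longleftrightarrow> (\<exists>S. V = {x. \<forall>p\<in>S. peval x p = 0})"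

definition zariski_closure :: "('v \<Rightarrow> real) set \<Rightarrow> ('v \<Rightarrow> real) set" where
  "zariski_closure Z = algebraic_set hull Z"

definition vanishing_ideal :: "('v \<Rightarrow> real) set \<Rightarrow> 'v rpoly set" where
  "vanishing_ideal Z = {p. \<forall>x\<in>Z. peval x p = 0}"

text \<open>Supremum of the lengths \<open>k\<close> of strict chains \<open>P 0 \<subset> \<dots> \<subset> P k\<close> of prime ideals.
  With values in \<open>enat\<close>, the zero ring gets dimension 0 instead of minus infinity.\<close>

definition krull_dim :: "('a, 'b) ring_scheme \<Rightarrow> enat" where
  "krull_dim R = (SUP k \<in> {k. \<exists>P. (\<forall>i\<le>k. primeideal (P i) R) \<and> (\<forall>i<k. P i \<subset> P (Suc i))}. enat k)"

text \<open>Rows and columns are selected by injective maps, so every minor occurs up to sign,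
  together with its negative.\<close>

definition minors3 :: "'a::comm_ring_1^'c^'r \<Rightarrow> 'a set" where
  "minors3 A = {det (\<chi> s t. A $ r s $ c t) | (r :: 3 \<Rightarrow> 'r) (c :: 3 \<Rightarrow> 'c). inj r \<and> inj c}"


section \<open>The network\<close>

text \<open>\<open>CNum k i\<close> is the variable for the coefficient of \<open>x\<^sub>i\<close> in the \<open>k\<close>-th numerator;
  \<open>CDen (Upair i j)\<close> is the one for the coefficient of \<open>x\<^sub>i x\<^sub>j\<close> in the denominator. An
  unordered pair may have equal components, so \<open>'n uprod\<close> has exactly one element for each
  quadratic monomial.\<close>

datatype ('m, 'n) coeff_var = CNum 'm 'n | CDen "'n uprod"

text \<open>The sum in the second equation runs over the (one or two) ordered pairs representing
  \<open>p\<close>: it is the coefficient of \<open>x\<^sub>i x\<^sub>j\<close> in \<open>\<ell>\<^sub>1 \<ell>\<^sub>2\<close>, where \<open>p = Upair i j\<close>.\<close>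

fun network_coeffs ::
  "real^'n^2 \<Rightarrow> real^2^'m \<Rightarrow> ('m::finite, 'n::finite) coeff_var \<Rightarrow> real" where
  "network_coeffs W1 W2 (CNum k i) = W2 $ k $ 1 * W1 $ 2 $ i + W2 $ k $ 2 * W1 $ 1 $ i"
| "network_coeffs W1 W2 (CDen p) = (\<Sum>(i, j) | Upair i j = p. W1 $ 1 $ i * W1 $ 2 $ j)"

lemma network_coeffs_diag:
  "network_coeffs W1 W2 (CDen (Upair i i)) = W1 $ 1 $ i * W1 $ 2 $ i"
proof -
  have "{q. case q of (a, b) \<Rightarrow> Upair a b = Upair i i} = {(i, i)}" by auto
  then show ?thesis by simp
qed

lemma network_coeffs_offdiag:
  assumes "i \<noteq> j"
  shows "network_coeffs W1 W2 (CDen (Upair i j)) = W1 $ 1 $ i * W1 $ 2 $ j + W1 $ 1 $ j * W1 $ 2 $ i"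
proof -
  have "{q. case q of (a, b) \<Rightarrow> Upair a b = Upair i j} = {(i, j), (j, i)}" by auto
  then show ?thesis using assms by simp
qed

definition rational_network :: "real^'n^2 \<Rightarrow> real^2^'m \<Rightarrow> real^'n \<Rightarrow> real^'m" where
  "rational_network W1 W2 x = W2 *v (\<chi> j. 1 / (W1 *v x) $ j)"

text \<open>Where it is defined, the network is the quotient of forms with coefficients
  \<^const>\<open>network_coeffs\<close>.\<close>

lemma rational_network_eq_quotient:
  fixes W1 :: "real^'n::finite^2" and W2 :: "real^2^'m::finite"
  assumes "(W1 *v x) $ 1 \<noteq> 0" "(W1 *v x) $ 2 \<noteq> 0"
  shows "rational_network W1 W2 x $ k =
    (\<Sum>i\<in>UNIV. network_coeffs W1 W2 (CNum k i) * x $ i) /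
    (\<Sum>p\<in>UNIV. network_coeffs W1 W2 (CDen p :: ('m, 'n) coeff_var) *
        case_uprod (Abs_commute (\<lambda>i j. x $ i * x $ j)) p)"
proof -
  let ?m = "case_uprod (Abs_commute (\<lambda>i j. x $ i * x $ j))"
  have ac: "apply_commute (Abs_commute (\<lambda>i j. x $ i * x $ j)) i j = x $ i * x $ j" for i j
    by (subst Abs_commute_inverse) auto
  have "(W1 *v x) $ 1 * (W1 *v x) $ 2
      = (\<Sum>q\<in>UNIV. W1 $ 1 $ fst q * W1 $ 2 $ snd q * ?m (Upair (fst q) (snd q)))"
  proof -
    have "(W1 *v x) $ 1 * (W1 *v x) $ 2
        = (\<Sum>i\<in>UNIV. \<Sum>j\<in>UNIV. (W1 $ 1 $ i * x $ i) * (W1 $ 2 $ j * x $ j))"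
      unfolding matrix_vector_mult_def by (simp add: sum_product)
    also have "\<dots> = (\<Sum>q\<in>UNIV \<times> UNIV. (W1 $ 1 $ fst q * x $ fst q) * (W1 $ 2 $ snd q * x $ snd q))"
      by (simp only: sum.cartesian_product case_prod_unfold)
    finally show ?thesis unfolding UNIV_Times_UNIV case_uprod_simps ac
      by (simp only: mult.assoc mult.left_commute)
  qed
  also have "\<dots> = (\<Sum>p\<in>(UNIV :: 'n uprod set). \<Sum>q | q \<in> UNIV \<and> Upair (fst q) (snd q) = p.
      W1 $ 1 $ fst q * W1 $ 2 $ snd q * ?m (Upair (fst q) (snd q)))"
    by (rule sum.group[symmetric]) auto
  also have "\<dots> = (\<Sum>p\<in>UNIV. network_coeffs W1 W2 (CDen p :: ('m, 'n) coeff_var) * ?m p)"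
    by (auto simp: case_prod_unfold sum_distrib_right intro!: sum.cong)
  finally have den: "(W1 *v x) $ 1 * (W1 *v x) $ 2 = \<dots>" .
  have num: "W2 $ k $ 1 * (W1 *v x) $ 2 + W2 $ k $ 2 * (W1 *v x) $ 1
      = (\<Sum>i\<in>UNIV. network_coeffs W1 W2 (CNum k i) * x $ i)"
    by (simp add: matrix_vector_mult_def sum_distrib_left sum.distrib algebra_simps)
  have "rational_network W1 W2 x $ k = W2 $ k $ 1 / (W1 *v x) $ 1 + W2 $ k $ 2 / (W1 *v x) $ 2"
  proof -
    have "(W2 *v y) $ k = W2 $ k $ 1 * y $ 1 + W2 $ k $ 2 * y $ 2" for y
      by (simp add: matrix_vector_mult_def sum_2)
    then show ?thesis unfolding rational_network_def by simp
  qed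
  also have "\<dots> = (W2 $ k $ 1 * (W1 *v x) $ 2 + W2 $ k $ 2 * (W1 *v x) $ 1) /
      ((W1 *v x) $ 1 * (W1 *v x) $ 2)"
    by (simp only: add_frac_eq[OF assms])
  finally show ?thesis unfolding num den .
qed

definition neuromanifold :: "(('m::finite, 'n::finite) coeff_var \<Rightarrow> real) set" where
  "neuromanifold = {network_coeffs W1 W2 | (W1 :: real^'n^2) (W2 :: real^2^'m). True}"

definition neurovariety :: "(('m::finite, 'n::finite) coeff_var \<Rightarrow> real) set" where
  "neurovariety = zariski_closure neuromanifold"

definition network_ideal :: "('m::finite, 'n::finite) coeff_var rpoly set" where
  "network_ideal = vanishing_ideal neurovariety"

text \<open>Column \<open>Inl k\<close> is the \<open>k\<close>-th column and column \<open>Inr j\<close> is the \<open>(m + j)\<close>-th one.\<close>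

definition coeff_matrix :: "('m::finite, 'n::finite) coeff_var rpoly^('m + 'n)^'n" where
  "coeff_matrix = (\<chi> i c. case c of
      Inl k \<Rightarrow> pvar (CNum k i)
    | Inr j \<Rightarrow> if i = j then 2 * pvar (CDen (Upair i i)) else pvar (CDen (Upair i j)))"

end

theory Submission
  imports Defs
begin

text \<open>
  Write the matrix as \<open>M = (A | S)\<close> with \<open>S\<close> symmetric. On the network \<open>S\<close> is
  \<open>\<ell>\<^sub>1 \<ell>\<^sub>2\<^sup>T + \<ell>\<^sub>2 \<ell>\<^sub>1\<^sup>T\<close> and every column of \<open>A\<close> is a combination of \<open>\<ell>\<^sub>1\<close> and \<open>\<ell>\<^sub>2\<close>, so \<open>M\<close> has
  rank at most 2 and the minors vanish (\<open>minors_vanish\<close>). Three more things have to be shown: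
  the minors generate, no chain of primes is longer than \<open>2(n + m) - 1\<close>, and some chain has
  that length.

  \<^emph>\<open>Generators.\<close> Treat inputs and outputs alike as vertices, and each coefficient as an edge
  between the two vertices that it belongs to. If \<open>x\<close> collects \<open>\<ell>\<^sub>1\<close> with the first column of
  the outer weights and \<open>y\<close> collects \<open>\<ell>\<^sub>2\<close> with the second one, then the coefficient of the edge
  \<open>ab\<close> is \<open>x\<^sub>a y\<^sub>b + y\<^sub>a x\<^sub>b\<close>, up to a factor 2 for loops (\<open>net_edge\<close>). Under the real
  substitution \<open>x = s + t\<close>, \<open>y = s - t\<close> this becomes \<open>2(s\<^sub>a s\<^sub>b - t\<^sub>a t\<^sub>b)\<close>: the neurovariety is,
  over the complex numbers and up to scaling of the coordinates, the secant variety of the toric variety \<open>C\<^sub>a\<^sub>b = s\<^sub>a s\<^sub>b\<close>. The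
  initial monomials of a secant variety can be read off from those of the toric variety, as in
  work of Simis and Ulrich and of Sturmfels and Sullivant. Order the vertices linearly, inputs
  before outputs, and weight the edge \<open>ab\<close> by the product of the two positions. By the
  rearrangement inequality the diagonal term of a minor is its unique heaviest term. Hence,
  modulo the minors, every polynomial is a combination of monomials that contain no three
  edges strictly increasing in both ends (\<open>reducible_all\<close>). Such a monomial is a product of
  two monomials without a pair of strictly increasing edges (\<open>three_chain_free_split\<close>), and a
  monomial without such a pair is the unique lightest one with its vertex degrees, that is,
  with its value on the toric variety (\<open>nested_minimal\<close>). Now let \<open>f\<close> be reduced and vanish
  on the network, and let \<open>\<mu> = \<nu> \<nu>'\<close> be split in this way, where \<open>\<mu>\<close> is a heaviest monomial
  of \<open>f\<close>. In the parameters, the coefficient in \<open>f\<close> of the value of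
  \<open>\<nu>\<close> at \<open>s\<close> times the value of \<open>\<nu>'\<close> at \<open>t\<close> receives a contribution from \<open>\<mu>\<close> alone, because
  every other monomial of \<open>f\<close> that could contribute would be heavier. So \<open>f = 0\<close>
  (\<open>reduced_vanishing_eq_0\<close>).

  \<^emph>\<open>Upper bound for the dimension.\<close> If \<open>P \<subset> Q\<close> are primes, then an element of \<open>Q\<close> outside \<open>P\<close>
  can be added to a family that is algebraically independent modulo \<open>Q\<close>, and the result is
  independent modulo \<open>P\<close> (\<open>alg_independent_Cons\<close>). A chain of length \<open>k\<close> therefore yields \<open>k\<close>
  polynomials that are independent on the network. As functions of the \<open>2(n + m)\<close> parameters
  they involve only monomials with equal total degree in \<open>x\<close> and in \<open>y\<close>, which leaves
  \<open>2(n + m) - 1\<close> free exponents. Comparing the growth of the number of power products with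
  that of the number of such monomials gives \<open>k \<le> 2(n + m) - 1\<close> (\<open>alg_independent_length\<close>).

  \<^emph>\<open>Lower bound.\<close> Setting more and more parameters to zero gives an increasing chain of
  primes. Killing the two parameters of one vertex after the other, outputs first, makes every
  step strict except the very last one, which would kill the last parameter
  (\<open>prime_chain_exists\<close>).
\<close>

section \<open>Polynomials as functions\<close>

lemma poly_mapping_sum_monomials:
  "(\<Sum>t\<in>Poly_Mapping.keys p. Poly_Mapping.single t (Poly_Mapping.lookup p t)) = p"
  by (rule poly_mapping_eqI)
    (simp add: lookup_sum lookup_single when_def in_keys_iff)

definition eval_monom :: "('v \<Rightarrow> real) \<Rightarrow> ('v \<Rightarrow>\<^sub>0 nat) \<Rightarrow> real" where
  "eval_monom x t = (\<Prod>v\<in>Poly_Mapping.keys t. x v ^ Poly_Mapping.lookup t v)"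

lemma eval_monom_superset:
  assumes "finite A" "Poly_Mapping.keys t \<subseteq> A"
  shows "eval_monom x t = (\<Prod>v\<in>A. x v ^ Poly_Mapping.lookup t v)"
  unfolding eval_monom_def using assms
  by (intro prod.mono_neutral_left) (auto simp: in_keys_iff)

lemma eval_monom_0 [simp]: "eval_monom x 0 = 1"
  by (simp add: eval_monom_def)

lemma eval_monom_add: "eval_monom x (s + t) = eval_monom x s * eval_monom x t"
proof -
  let ?A = "Poly_Mapping.keys s \<union> Poly_Mapping.keys t"
  have "Poly_Mapping.keys (s + t) \<subseteq> ?A" by (rule keys_add)
  then show ?thesis
    by (subst (1 2 3) eval_monom_superset[of ?A])
      (auto simp: lookup_add power_add prod.distrib)
qed

lemma peval_superset:
  assumes "finite A" "Poly_Mapping.keys p \<subseteq> A"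
  shows "peval x p = (\<Sum>t\<in>A. Poly_Mapping.lookup p t * eval_monom x t)"
  unfolding peval_def eval_monom_def[symmetric] using assms
  by (intro sum.mono_neutral_left) (auto simp: in_keys_iff)

lemma peval_eq: "peval x p = (\<Sum>t\<in>Poly_Mapping.keys p. Poly_Mapping.lookup p t * eval_monom x t)"
  by (rule peval_superset) auto

lemma peval_single [simp]: "peval x (Poly_Mapping.single t c) = c * eval_monom x t"
  by (subst peval_superset[of "{t}"]) auto

lemma peval_0 [simp]: "peval x 0 = 0"
  by (simp add: peval_eq)

lemma peval_1 [simp]: "peval x 1 = 1"
  using peval_single[of x 0 1] by (simp del: peval_single)

lemma peval_add [simp]: "peval x (p + q) = peval x p + peval x q"
proof -
  let ?A = "Poly_Mapping.keys p \<union> Poly_Mapping.keys q"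
  have "Poly_Mapping.keys (p + q) \<subseteq> ?A" by (rule keys_add)
  then show ?thesis
    by (subst (1 2 3) peval_superset[of ?A])
      (auto simp: lookup_add sum.distrib algebra_simps)
qed

lemma peval_sum [simp]: "peval x (sum f A) = (\<Sum>a\<in>A. peval x (f a))"
  by (induction A rule: infinite_finite_induct) auto

lemma peval_mult [simp]: "peval x (p * q) = peval x p * peval x q"
proof -
  let ?s = "\<lambda>p t. Poly_Mapping.single t (Poly_Mapping.lookup p t)"
  have "p * q = (\<Sum>t\<in>Poly_Mapping.keys p. ?s p t) * (\<Sum>t\<in>Poly_Mapping.keys q. ?s q t)"
    by (simp only: poly_mapping_sum_monomials)
  also have "\<dots> = (\<Sum>t\<in>Poly_Mapping.keys p. \<Sum>u\<in>Poly_Mapping.keys q. ?s p t * ?s q u)"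
    by (simp add: sum_product)
  finally have "peval x (p * q) = (\<Sum>t\<in>Poly_Mapping.keys p. \<Sum>u\<in>Poly_Mapping.keys q.
      (Poly_Mapping.lookup p t * eval_monom x t) * (Poly_Mapping.lookup q u * eval_monom x u))"
    by (simp add: mult_single eval_monom_add algebra_simps)
  then show ?thesis by (simp add: peval_eq sum_product)
qed

lemma peval_uminus [simp]: "peval x (- p) = - peval x p"
  using peval_add[of x p "- p"] by simp

lemma peval_diff [simp]: "peval x (p - q) = peval x p - peval x q"
  using peval_add[of x p "- q"] by simp

lemma peval_power [simp]: "peval x (p ^ k) = peval x p ^ k"
  by (induction k) auto

lemma peval_pvar [simp]: "peval x (pvar v) = x v"
  by (simp add: pvar_def) (simp add: eval_monom_def)

text \<open>The zero set of a single polynomial is algebraic, so it contains the closure of any set on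
  which the polynomial vanishes.\<close>

lemma vanishing_ideal_zariski_closure [simp]:
  "vanishing_ideal (zariski_closure Z) = vanishing_ideal Z"
proof
  show "vanishing_ideal (zariski_closure Z) \<subseteq> vanishing_ideal Z"
    unfolding vanishing_ideal_def zariski_closure_def using hull_subset[of Z algebraic_set] by auto
  show "vanishing_ideal Z \<subseteq> vanishing_ideal (zariski_closure Z)"
  proof
    fix p assume p: "p \<in> vanishing_ideal Z"
    have "algebraic_set {x. \<forall>q\<in>{p}. peval x q = 0}"
      unfolding algebraic_set_def by blast
    moreover have "Z \<subseteq> {x. \<forall>q\<in>{p}. peval x q = 0}"
      using p by (auto simp: vanishing_ideal_def)
    ultimately have "zariski_closure Z \<subseteq> {x. \<forall>q\<in>{p}. peval x q = 0}"
      unfolding zariski_closure_def by (intro hull_minimal)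
    then show "p \<in> vanishing_ideal (zariski_closure Z)"
      by (auto simp: vanishing_ideal_def)
  qed
qed

section \<open>Independence of characters\<close>

text \<open>Dedekind's argument, for functions that are multiplicative with respect to an arbitrary
  operation \<open>m\<close>: shifting a relation by a point that separates two characters and subtracting a
  multiple of the relation removes one of them. It serves to compare coefficients of
  polynomial functions, monomials being characters.\<close>

lemma characters_independent:
  fixes ch :: "'k \<Rightarrow> 'x \<Rightarrow> 'f::field"
  assumes "finite K"
    and mult: "\<And>k x y. k \<in> K \<Longrightarrow> ch k (m x y) = ch k x * ch k y"
    and one: "\<And>k. k \<in> K \<Longrightarrow> ch k e = 1"
    and distinct: "\<And>k l. k \<in> K \<Longrightarrow> l \<in> K \<Longrightarrow> k \<noteq> l \<Longrightarrow> \<exists>x. ch k x \<noteq> ch l x"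
    and zero: "\<And>x. (\<Sum>k\<in>K. c k * ch k x) = 0"
    and "k \<in> K"
  shows "c k = 0"
  using assms
proof (induction K arbitrary: c k rule: finite_induct)
  case empty
  then show ?case by simp
next
  case (insert l K)
  \<comment> \<open>The point \<open>x0\<close> separates \<open>k\<close> from \<open>l\<close>, and the combined relation no longer contains \<open>l\<close>.\<close>
  have rest: "c k = 0" if "k \<in> K" for k
  proof -
    obtain x0 where x0: "ch k x0 \<noteq> ch l x0"
      using insert.prems(3)[of k l] insert.hyps \<open>k \<in> K\<close> by auto
    have "c k * (ch k x0 - ch l x0) = 0"
    proof (rule insert.IH[where c = "\<lambda>k. c k * (ch k x0 - ch l x0)"])
      fix x
      have "(\<Sum>k\<in>insert l K. c k * ch k (m x0 x)) = (\<Sum>k\<in>insert l K. c k * (ch k x0 * ch k x))"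
        using insert.prems(1) by (intro sum.cong) auto
      then have "(\<Sum>k\<in>insert l K. c k * (ch k x0 * ch k x)) - ch l x0 * (\<Sum>k\<in>insert l K. c k * ch k x) = 0"
        using insert.prems(4)[of "m x0 x"] insert.prems(4)[of x] by simp
      then show "(\<Sum>k\<in>K. c k * (ch k x0 - ch l x0) * ch k x) = 0"
        using insert.hyps
        by (simp add: sum_distrib_left algebra_simps sum_subtractf)
    qed (use insert.prems that in auto)
    then show ?thesis using x0 by simp
  qed
  have "c l = 0"
    using insert.prems(4)[of e] insert.hyps rest insert.prems(2)[of l] by simp
  then show ?case using rest insert.prems(5) by auto
qed

section \<open>Monomials as multigraphs\<close>

text \<open>Inputs \<open>Inl i\<close> and outputs \<open>Inr k\<close> are the vertices of a graph whose edges are the variables: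
  each pair of inputs, equal or not, is joined by an edge, and so is each input with each
  output. Two outputs are not joined. Every edge has an input end, which is its row in the
  matrix, while the other end is its column; an edge between two different inputs occurs
  twice, in symmetric positions.\<close>

fun edge :: "'n \<Rightarrow> 'n + 'm \<Rightarrow> ('m, 'n) coeff_var" where
  "edge i (Inl j) = CDen (Upair i j)"
| "edge i (Inr k) = CNum k i"

lemma edge_surj: "\<exists>i c. v = edge i c"
proof (cases v)
  case (CNum k i)
  then have "v = edge i (Inr k)" by simp
  then show ?thesis by blast
next
  case (CDen p)
  obtain i j where "p = Upair i j" by (cases p)
  then have "v = edge i (Inl j)" using CDen by simp
  then show ?thesis by blast
qed

lemma edge_eq_iff: "edge i c = edge j d \<longleftrightarrow> i = j \<and> c = d \<or> c = Inl j \<and> d = Inl i"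
  by (cases c; cases d) auto

lemma finite_coeff_var: "finite (UNIV :: ('m::finite, 'n::finite) coeff_var set)"
proof -
  have "(UNIV :: ('m, 'n) coeff_var set) = (\<lambda>p. edge (fst p) (snd p)) ` UNIV"
    unfolding set_eq_iff image_iff using edge_surj by auto
  then show ?thesis by (metis finite finite_imageI)
qed

definition unit_at :: "'v \<Rightarrow> 'v \<Rightarrow> nat" where
  "unit_at v w = of_bool (w = v)"

text \<open>Monomials are handled as exponent functions here; this takes out one factor.\<close>

lemma split_off_unit:
  assumes "\<mu> v \<noteq> (0::nat)"
  obtains \<nu> where "\<mu> = (\<lambda>w. \<nu> w + unit_at v w)"
proof
  show "\<mu> = (\<lambda>w. (\<mu>(v := \<mu> v - 1)) w + unit_at v w)"
    using assms by (auto simp: unit_at_def fun_eq_iff)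
qed

text \<open>The products of positions, which will serve as weights of edges, are strictly supermodular.\<close>

lemma uncross_less:
  fixes a b c d :: nat
  assumes "a < b" "c < d"
  shows "a * d + b * c < a * c + b * d"
proof -
  obtain k where b: "b = a + Suc k" using assms less_imp_Suc_add by fastforce
  obtain l where d: "d = c + Suc l" using assms less_imp_Suc_add by fastforce
  show ?thesis unfolding b d by (simp add: algebra_simps)
qed

text \<open>A linear order of the vertices with the inputs first. The lower end of every edge is then an
  input, so three edges that increase in both ends have three inputs as rows, and all nine
  entries of the corresponding submatrix are edges.\<close>

locale vertex_order =
  fixes idx :: "'n::finite + 'm::finite \<Rightarrow> nat"
  assumes inj_idx: "inj idx"
    and idx_less: "idx (Inl i) < idx (Inr k)"
begin

lemma idx_eq_iff [simp]: "idx a = idx b \<longleftrightarrow> a = b"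
  using inj_idx by (auto simp: inj_def)

text \<open>The position of the variable on or above the diagonal, if both ends are inputs.\<close>

definition sorted_ends :: "('m, 'n) coeff_var \<Rightarrow> 'n \<times> ('n + 'm)" where
  "sorted_ends v = (SOME (i, c). v = edge i c \<and> idx (Inl i) \<le> idx c)"

definition row :: "('m, 'n) coeff_var \<Rightarrow> 'n" where "row v = fst (sorted_ends v)"
definition col :: "('m, 'n) coeff_var \<Rightarrow> 'n + 'm" where "col v = snd (sorted_ends v)"
definition lo :: "('m, 'n) coeff_var \<Rightarrow> nat" where "lo v = idx (Inl (row v))"
definition hi :: "('m, 'n) coeff_var \<Rightarrow> nat" where "hi v = idx (col v)"

lemma edge_row_col: "edge (row v) (col v) = v" and lo_le_hi: "lo v \<le> hi v"
proof -
  obtain i c where v: "v = edge i c" using edge_surj[of v] by blast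
  have "\<exists>p. case p of (i, c) \<Rightarrow> v = edge i c \<and> idx (Inl i) \<le> idx c"
  proof (cases "idx (Inl i) \<le> idx c")
    case True
    then show ?thesis using v by auto
  next
    case False
    then obtain j where c: "c = Inl j"
      using idx_less by (metis less_imp_le old.sum.exhaust)
    then have "v = edge j (Inl i)" using v by (simp add: edge_eq_iff)
    then show ?thesis using False c by (intro exI[of _ "(j, Inl i)"]) simp
  qed
  then have "case sorted_ends v of (i, c) \<Rightarrow> v = edge i c \<and> idx (Inl i) \<le> idx c"
    unfolding sorted_ends_def by (rule someI_ex)
  then show "edge (row v) (col v) = v" "lo v \<le> hi v"
    by (auto simp: row_def col_def lo_def hi_def split: prod.splits)
qed

lemma edge_determined:
  assumes "lo v = lo w" "hi v = hi w"
  shows "v = w"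
  using assms edge_row_col unfolding lo_def hi_def idx_eq_iff by (metis Inl_inject)

text \<open>A loop counts twice at its vertex.\<close>

definition incidence :: "('m, 'n) coeff_var \<Rightarrow> 'n + 'm \<Rightarrow> nat" where
  "incidence v a = of_bool (a = Inl (row v)) + of_bool (a = col v)"

lemma edge_eqD:
  assumes "edge i c = v"
  shows "row v = i \<and> col v = c \<or> col v = Inl i \<and> c = Inl (row v)"
proof -
  have "edge i c = edge (row v) (col v)" using assms edge_row_col by metis
  then show ?thesis unfolding edge_eq_iff by metis
qed

lemma incidence_edge: "incidence (edge i c) a = of_bool (a = Inl i) + of_bool (a = c)"
proof -
  obtain v where v: "edge i c = v" by blast
  from edge_eqD[OF v] show ?thesis
    unfolding v incidence_def by (elim disjE conjE) simp_all
qed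

text \<open>The product of the positions of the ends does not depend on which end comes first.\<close>

lemma lo_hi_edge: "lo (edge i c) * hi (edge i c) = idx (Inl i) * idx c"
proof -
  obtain v where v: "edge i c = v" by blast
  from edge_eqD[OF v] show ?thesis
    unfolding v lo_def hi_def by (elim disjE conjE) simp_all
qed

text \<open>The exponent vector of the monomial after the substitution \<open>C\<^sub>a\<^sub>b = s\<^sub>a s\<^sub>b\<close>; two monomials agree
  on the toric variety precisely if they have the same vertex degrees.\<close>

definition vertex_degrees :: "(('m, 'n) coeff_var \<Rightarrow> nat) \<Rightarrow> 'n + 'm \<Rightarrow> nat" where
  "vertex_degrees \<mu> a = (\<Sum>v\<in>UNIV. \<mu> v * incidence v a)"

definition weight :: "(('m, 'n) coeff_var \<Rightarrow> nat) \<Rightarrow> nat" where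
  "weight \<mu> = (\<Sum>v\<in>UNIV. \<mu> v * (lo v * hi v))"

lemma vertex_degrees_add: "vertex_degrees (\<lambda>v. \<mu> v + \<nu> v) a = vertex_degrees \<mu> a + vertex_degrees \<nu> a"
  by (simp add: vertex_degrees_def sum.distrib algebra_simps)

lemma weight_add: "weight (\<lambda>v. \<mu> v + \<nu> v) = weight \<mu> + weight \<nu>"
  by (simp add: weight_def sum.distrib algebra_simps)

lemma sum_unit_at: "(\<Sum>w\<in>UNIV. unit_at v w * f w) = (f v :: nat)"
  for v :: "('m, 'n) coeff_var"
  by (simp add: unit_at_def of_bool_def if_distrib[of "\<lambda>x. x * _"] finite_coeff_var cong: if_cong)

lemma vertex_degrees_unit_at: "vertex_degrees (unit_at v) a = incidence v a"
  unfolding vertex_degrees_def by (rule sum_unit_at)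

lemma weight_unit_at: "weight (unit_at v) = lo v * hi v"
  unfolding weight_def by (rule sum_unit_at)

lemma vertex_degrees_eq_0_iff: "vertex_degrees \<mu> a = 0 \<longleftrightarrow> (\<forall>v. \<mu> v \<noteq> 0 \<longrightarrow> a \<noteq> Inl (row v) \<and> a \<noteq> col v)"
proof -
  have inc: "incidence v a = 0 \<longleftrightarrow> a \<noteq> Inl (row v) \<and> a \<noteq> col v" for v
    unfolding incidence_def by simp
  show ?thesis
    unfolding vertex_degrees_def sum_eq_0_iff[OF finite_coeff_var] mult_eq_0_iff inc
    by (simp only: ball_UNIV imp_conv_disj not_not)
qed

definition below :: "('m, 'n) coeff_var \<Rightarrow> ('m, 'n) coeff_var \<Rightarrow> bool" where
  "below v w \<longleftrightarrow> lo v < lo w \<and> hi v < hi w"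

text \<open>For edges seen as intervals of positions, this says that of any two edges occurring in the
  monomial one contains the other, possibly with a common end.\<close>

definition nested :: "(('m, 'n) coeff_var \<Rightarrow> nat) \<Rightarrow> bool" where
  "nested \<mu> \<longleftrightarrow> (\<forall>v w. \<mu> v \<noteq> 0 \<longrightarrow> \<mu> w \<noteq> 0 \<longrightarrow> \<not> below v w)"

definition three_chain_free :: "(('m, 'n) coeff_var \<Rightarrow> nat) \<Rightarrow> bool" where
  "three_chain_free \<mu> \<longleftrightarrow>
    (\<forall>u v w. \<mu> u \<noteq> 0 \<longrightarrow> \<mu> v \<noteq> 0 \<longrightarrow> \<mu> w \<noteq> 0 \<longrightarrow> \<not> (below u v \<and> below v w))"

text \<open>The edge at the first vertex that occurs and the edge at the last one cannot increase
  strictly in both ends, so one of them joins these two vertices.\<close>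

lemma nested_outermost:
  assumes "nested \<mu>" "\<mu> \<noteq> (\<lambda>_. 0)"
  shows "\<exists>u. \<mu> u \<noteq> 0 \<and> lo u = Min (idx ` {a. vertex_degrees \<mu> a \<noteq> 0}) \<and> hi u = Max (idx ` {a. vertex_degrees \<mu> a \<noteq> 0})"
proof -
  define A where "A = idx ` {a. vertex_degrees \<mu> a \<noteq> 0}"
  obtain v0 where v0: "\<mu> v0 \<noteq> 0" using assms(2) by fastforce
  have in_A: "lo v \<in> A" "hi v \<in> A" if "\<mu> v \<noteq> 0" for v
    using that by (auto simp: A_def lo_def hi_def vertex_degrees_eq_0_iff)
  have fin: "finite A" "A \<noteq> {}" using in_A[OF v0] by (auto simp: A_def)
  have A_cases: "\<exists>v. \<mu> v \<noteq> 0 \<and> (x = lo v \<or> x = hi v)" if "x \<in> A" for x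
    using that by (auto simp: A_def lo_def hi_def vertex_degrees_eq_0_iff)
  have bounds: "Min A \<le> lo v" "lo v \<le> hi v" "hi v \<le> Max A" if "\<mu> v \<noteq> 0" for v
    using in_A[OF that] fin lo_le_hi by auto
  obtain v where v: "\<mu> v \<noteq> 0" "Min A = lo v \<or> Min A = hi v"
    using A_cases[OF Min_in[OF fin]] by blast
  have lo_v: "lo v = Min A" using bounds[OF v(1)] v(2) by (elim disjE) linarith+
  obtain w where w: "\<mu> w \<noteq> 0" "Max A = lo w \<or> Max A = hi w"
    using A_cases[OF Max_in[OF fin]] by blast
  have hi_w: "hi w = Max A" using bounds[OF w(1)] w(2) by (elim disjE) linarith+
  have "\<not> below v w" using assms(1) v(1) w(1) unfolding nested_def by blast
  then have "lo w = Min A \<or> hi v = Max A"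
    using bounds[OF v(1)] bounds[OF w(1)] lo_v hi_w unfolding below_def by linarith
  then show ?thesis unfolding A_def[symmetric] using v(1) w(1) lo_v hi_w by blast
qed

text \<open>Both monomials contain the edge from the first to the last vertex that occurs, since these
  vertices are determined by the degrees. Divide by it and repeat.\<close>

lemma nested_unique:
  assumes "nested \<mu>" "nested \<nu>" "vertex_degrees \<mu> = vertex_degrees \<nu>"
  shows "\<mu> = \<nu>"
  using assms
proof (induction "\<Sum>v\<in>UNIV. \<mu> v" arbitrary: \<mu> \<nu> rule: less_induct)
  case less
  have zero_iff: "\<rho> = (\<lambda>_. 0) \<longleftrightarrow> vertex_degrees \<rho> = (\<lambda>_. 0)" for \<rho>
    by (auto simp: fun_eq_iff vertex_degrees_eq_0_iff)
  show ?case
  proof (cases "\<mu> = (\<lambda>_. 0)")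
    case True
    then show ?thesis using zero_iff less.prems(3) by metis
  next
    case False
    then have "\<nu> \<noteq> (\<lambda>_. 0)" using zero_iff less.prems(3) by metis
    then obtain u where u: "\<mu> u \<noteq> 0" "\<nu> u \<noteq> 0"
      using nested_outermost[OF less.prems(1) False] nested_outermost[OF less.prems(2)]
        less.prems(3) edge_determined by metis
    obtain \<mu>' where \<mu>': "\<mu> = (\<lambda>w. \<mu>' w + unit_at u w)" using split_off_unit[of \<mu>, OF u(1)] by blast
    obtain \<nu>' where \<nu>': "\<nu> = (\<lambda>w. \<nu>' w + unit_at u w)" using split_off_unit[of \<nu>, OF u(2)] by blast
    have "\<mu>' = \<nu>'"
    proof (rule less.hyps)
      show "sum \<mu>' UNIV < sum \<mu> UNIV"
        unfolding \<mu>' using sum_unit_at[of u "\<lambda>_. 1"] by (simp add: sum.distrib)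
      show "nested \<mu>'" "nested \<nu>'"
        using less.prems(1,2) unfolding \<mu>' \<nu>' nested_def by auto
      show "vertex_degrees \<mu>' = vertex_degrees \<nu>'"
        using less.prems(3) by (auto simp: \<mu>' \<nu>' vertex_degrees_add fun_eq_iff)
    qed
    then show ?thesis using \<mu>' \<nu>' by simp
  qed
qed

text \<open>Nested monomials are the standard monomials of the toric variety for this weight. If a monomial
  contains edges \<open>ij\<close> and \<open>kl\<close> increasing in both ends, then replacing them by \<open>il\<close> and \<open>kj\<close>
  keeps the vertex degrees and lowers the weight; at the bottom of this process only the
  nested monomial can remain, by uniqueness.\<close>

lemma nested_minimal:
  assumes "nested \<nu>" "vertex_degrees \<mu> = vertex_degrees \<nu>"
  shows "weight \<nu> \<le> weight \<mu> \<and> (weight \<mu> = weight \<nu> \<longrightarrow> \<mu> = \<nu>)"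
  using assms(2)
proof (induction "weight \<mu>" arbitrary: \<mu> rule: less_induct)
  case less
  show ?case
  proof (cases "nested \<mu>")
    case True
    then show ?thesis using nested_unique assms(1) less.prems by auto
  next
    case False
    then obtain v w where vw: "\<mu> v \<noteq> 0" "\<mu> w \<noteq> 0" "below v w" by (auto simp: nested_def)
    obtain \<mu>1 where \<mu>1: "\<mu> = (\<lambda>x. \<mu>1 x + unit_at v x)" using split_off_unit[of \<mu>, OF vw(1)] by blast
    have "\<mu>1 w \<noteq> 0" using vw by (auto simp: \<mu>1 unit_at_def below_def)
    then obtain \<mu>2 where \<mu>2: "\<mu>1 = (\<lambda>x. \<mu>2 x + unit_at w x)" using split_off_unit[of \<mu>1] by blast
    define \<mu>' where "\<mu>' = (\<lambda>x. \<mu>2 x + unit_at (edge (row v) (col w)) x + unit_at (edge (row w) (col v)) x)"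
    have "vertex_degrees \<mu>' a = vertex_degrees \<mu> a" for a
      unfolding \<mu>'_def \<mu>1 \<mu>2 vertex_degrees_add vertex_degrees_unit_at incidence_edge
      by (simp add: incidence_def)
    then have c: "vertex_degrees \<mu>' = vertex_degrees \<nu>" using less.prems by (simp add: fun_eq_iff)
    have e: "lo (edge (row v) (col w)) * hi (edge (row v) (col w)) = lo v * hi w"
        "lo (edge (row w) (col v)) * hi (edge (row w) (col v)) = lo w * hi v"
      unfolding lo_hi_edge by (simp_all only: lo_def hi_def)
    have "weight \<mu> = weight \<mu>2 + lo w * hi w + lo v * hi v"
      unfolding \<mu>1 \<mu>2 weight_add weight_unit_at by (rule refl)
    moreover have "weight \<mu>' = weight \<mu>2 + lo v * hi w + lo w * hi v"
      unfolding \<mu>'_def weight_add weight_unit_at e by (rule refl)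
    moreover have "lo v * hi w + lo w * hi v < lo v * hi v + lo w * hi w"
      using vw(3) unfolding below_def by (intro uncross_less) auto
    ultimately have lt: "weight \<mu>' < weight \<mu>" by linarith
    then have "weight \<nu> \<le> weight \<mu>'" using less.hyps[OF lt c] by blast
    then show ?thesis using lt by simp
  qed
qed

text \<open>Take \<open>\<nu>\<close> to consist of the edges that lie above no other edge of \<open>\<mu>\<close>. If an edge of the rest
  were below another edge of the rest, it would be the middle of a chain of three.\<close>

lemma three_chain_free_split:
  assumes "three_chain_free \<mu>"
  obtains \<nu> where "\<And>v. \<nu> v \<le> \<mu> v" "nested \<nu>" "nested (\<lambda>v. \<mu> v - \<nu> v)"
proof
  define \<nu> where "\<nu> v = (if \<exists>w. \<mu> w \<noteq> 0 \<and> below w v then 0 else \<mu> v)" for v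
  have nonzero: "\<mu> v \<noteq> 0 \<and> \<not> (\<exists>w. \<mu> w \<noteq> 0 \<and> below w v)" if "\<nu> v \<noteq> 0" for v
    using that by (cases "\<exists>w. \<mu> w \<noteq> 0 \<and> below w v") (simp_all only: \<nu>_def if_True if_False simp_thms)
  have nonzero': "\<mu> v \<noteq> 0 \<and> (\<exists>w. \<mu> w \<noteq> 0 \<and> below w v)" if "\<mu> v - \<nu> v \<noteq> 0" for v
    using that by (cases "\<exists>w. \<mu> w \<noteq> 0 \<and> below w v") (simp_all only: \<nu>_def if_True if_False diff_zero diff_self_eq_0 simp_thms)
  show "\<nu> v \<le> \<mu> v" for v by (simp add: \<nu>_def)
  show "nested \<nu>" unfolding nested_def using nonzero by blast
  show "nested (\<lambda>v. \<mu> v - \<nu> v)"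
    using assms nonzero' unfolding nested_def three_chain_free_def by blast
qed

end

lemma exists_vertex_order: "\<exists>idx :: 'n::finite + 'm::finite \<Rightarrow> nat. vertex_order idx"
proof -
  obtain f :: "'n \<Rightarrow> nat" where f: "inj f" using finite_imp_inj_to_nat_seg[of "UNIV :: 'n set"] by auto
  obtain g :: "'m \<Rightarrow> nat" where g: "inj g" using finite_imp_inj_to_nat_seg[of "UNIV :: 'm set"] by auto
  define N where "N = Suc (Max (range f))"
  have N: "f i < N" for i unfolding N_def by (simp add: le_imp_less_Suc)
  define idx where "idx = case_sum f (\<lambda>k. N + g k)"
  have "f i \<noteq> N + g k" for i k using N[of i] by simp
  then have "idx a = idx b \<Longrightarrow> a = b" for a b
    using injD[OF f] injD[OF g] by (cases a; cases b) (auto simp: idx_def dest: sym)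
  then have "inj idx" by (rule injI)
  then have "vertex_order idx"
    by unfold_locales (auto simp: idx_def trans_less_add1[OF N])
  then show ?thesis by blast
qed

section \<open>Ideals of the polynomial ring\<close>

text \<open>Ideals in the language of type classes, where arithmetic is better automated than in the
  ring record.\<close>

definition poly_ideal :: "'v rpoly set \<Rightarrow> bool" where
  "poly_ideal I \<longleftrightarrow> 0 \<in> I \<and> (\<forall>f\<in>I. \<forall>g\<in>I. f + g \<in> I) \<and> (\<forall>f\<in>I. \<forall>g. g * f \<in> I)"

lemma poly_idealD:
  assumes "poly_ideal I"
  shows "0 \<in> I" "f \<in> I \<Longrightarrow> g \<in> I \<Longrightarrow> f + g \<in> I" "f \<in> I \<Longrightarrow> g * f \<in> I" "f \<in> I \<Longrightarrow> - f \<in> I"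
    "f \<in> I \<Longrightarrow> g \<in> I \<Longrightarrow> f - g \<in> I"
proof -
  show 1: "0 \<in> I" "f \<in> I \<Longrightarrow> g \<in> I \<Longrightarrow> f + g \<in> I" "f \<in> I \<Longrightarrow> g * f \<in> I" for f g
    using assms by (auto simp: poly_ideal_def)
  show 2: "f \<in> I \<Longrightarrow> - f \<in> I" for f using 1(3)[of f "- 1"] by simp
  show "f \<in> I \<Longrightarrow> g \<in> I \<Longrightarrow> f - g \<in> I" using 1(2)[of f "- g"] 2[of g] by simp
qed

lemma cring_rpoly: "cring (rpoly_ring :: 'v rpoly ring)"
  by (rule cring_from_type_algebra)

lemma ring_rpoly: "ring (rpoly_ring :: 'v rpoly ring)"
  by (rule ring_from_type_algebra)

lemma rpoly_ring_simps [simp]: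
  "carrier (rpoly_ring :: 'v rpoly ring) = UNIV"
  "f \<oplus>\<^bsub>(rpoly_ring :: 'v rpoly ring)\<^esub> g = f + g"
  "f \<otimes>\<^bsub>(rpoly_ring :: 'v rpoly ring)\<^esub> g = f * g"
  "\<zero>\<^bsub>(rpoly_ring :: 'v rpoly ring)\<^esub> = 0"
  "\<one>\<^bsub>(rpoly_ring :: 'v rpoly ring)\<^esub> = 1"
  by (simp_all add: ring_of_type_algebra_def)

lemma ideal_iff_poly_ideal: "ideal I (rpoly_ring :: 'v rpoly ring) \<longleftrightarrow> poly_ideal I"
proof
  assume "ideal I (rpoly_ring :: 'v rpoly ring)"
  then interpret ideal I "rpoly_ring :: 'v rpoly ring" .
  show "poly_ideal I"
    using additive_subgroup.a_closed[OF is_additive_subgroup]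
      additive_subgroup.zero_closed[OF is_additive_subgroup] I_l_closed
    by (auto simp: poly_ideal_def)
next
  assume I: "poly_ideal I"
  interpret ring "rpoly_ring :: 'v rpoly ring" by (rule ring_rpoly)
  show "ideal I (rpoly_ring :: 'v rpoly ring)"
  proof (rule idealI)
    show "ring (rpoly_ring :: 'v rpoly ring)" by (rule ring_rpoly)
    show "subgroup I (add_monoid (rpoly_ring :: 'v rpoly ring))"
    proof (rule add.subgroupI)
      show "\<ominus>\<^bsub>(rpoly_ring :: 'v rpoly ring)\<^esub> f \<in> I" if "f \<in> I" for f
      proof -
        have "\<ominus>\<^bsub>(rpoly_ring :: 'v rpoly ring)\<^esub> f = - f"
          using minus_equality[of "- f" f] by simp
        then show ?thesis using poly_idealD(4)[OF I that] by simp
      qed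
    qed (use poly_idealD[OF I] in auto)
  qed (use poly_idealD[OF I] in \<open>auto simp: mult.commute\<close>)
qed

lemma poly_ideal_genideal: "poly_ideal (genideal (rpoly_ring :: 'v rpoly ring) S)"
  using ring.genideal_ideal[OF ring_rpoly] by (auto simp flip: ideal_iff_poly_ideal)

lemma genideal_superset: "S \<subseteq> genideal (rpoly_ring :: 'v rpoly ring) S"
  using ring.genideal_self[OF ring_rpoly] by auto

lemma genideal_least:
  assumes "poly_ideal I" "S \<subseteq> I"
  shows "genideal (rpoly_ring :: 'v rpoly ring) S \<subseteq> I"
  using ring.genideal_minimal[OF ring_rpoly] assms by (auto simp: ideal_iff_poly_ideal)

lemma poly_ideal_vanishing: "poly_ideal (vanishing_ideal Z)"
  by (auto simp: poly_ideal_def vanishing_ideal_def)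

section \<open>Reduction modulo the minors\<close>

definition triple :: "'x \<Rightarrow> 'x \<Rightarrow> 'x \<Rightarrow> 3 \<Rightarrow> 'x" where
  "triple a b c = (\<lambda>s. if s = 1 then a else if s = 2 then b else c)"

lemma triple_simps [simp]: "triple a b c 1 = a" "triple a b c 2 = b" "triple a b c 3 = c"
  by (simp_all add: triple_def)

lemma inj_triple:
  assumes "a \<noteq> b" "a \<noteq> c" "b \<noteq> c"
  shows "inj (triple a b c)"
proof (rule injI)
  fix s t assume "triple a b c s = triple a b c t"
  then show "s = t"
    using exhaust_3[of s] exhaust_3[of t] assms assms[symmetric]
    by (elim disjE) simp_all
qed

text \<open>The matrix has \<open>2 C\<^sub>2\<^sub>e\<^sub>i\<close> on the diagonal of its symmetric block.\<close>

definition entry_coeff :: "'n \<Rightarrow> 'n + 'm \<Rightarrow> real" where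
  "entry_coeff i c = (if c = Inl i then 2 else 1)"

lemma entry_coeff_nonzero [simp]: "entry_coeff i c \<noteq> 0"
  by (simp add: entry_coeff_def)

fun flip_col :: "'m + 'n \<Rightarrow> 'n + 'm" where
  "flip_col (Inl k) = Inr k" | "flip_col (Inr j) = Inl j"

lemma coeff_matrix_entry:
  "coeff_matrix $ i $ c =
    Poly_Mapping.single (Poly_Mapping.single (edge i (flip_col c)) 1) (entry_coeff i (flip_col c))"
proof -
  have "2 * pvar v = Poly_Mapping.single (Poly_Mapping.single v 1) 2" for v
    unfolding pvar_def using mult_single[of 0 "2::real" "Poly_Mapping.single v 1" 1]
    by (simp del: One_nat_def)
  then show ?thesis
    by (cases c) (auto simp: coeff_matrix_def entry_coeff_def pvar_def)
qed

lemma minor_mem_minors3: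
  assumes "i1 \<noteq> i2" "i1 \<noteq> i3" "i2 \<noteq> i3" "c1 \<noteq> c2" "c1 \<noteq> c3" "c2 \<noteq> c3"
  shows "det (\<chi> s t. A $ triple i1 i2 i3 s $ triple c1 c2 c3 t) \<in> minors3 A"
  unfolding minors3_def using inj_triple[OF assms(1-3)] inj_triple[OF assms(4-6)] by blast

text \<open>The rearrangement inequality for the five permutations of three numbers other than the
  identity, in the order in which the determinant is expanded.\<close>

lemma rearrangement3:
  fixes a1 a2 a3 b1 b2 b3 :: nat
  assumes "a1 < a2" "a2 < a3" "b1 < b2" "b2 < b3"
  shows "a1 * b2 + a2 * b3 + a3 * b1 < a1 * b1 + a2 * b2 + a3 * b3"
    "a1 * b3 + a2 * b1 + a3 * b2 < a1 * b1 + a2 * b2 + a3 * b3"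
    "a1 * b1 + a2 * b3 + a3 * b2 < a1 * b1 + a2 * b2 + a3 * b3"
    "a1 * b2 + a2 * b1 + a3 * b3 < a1 * b1 + a2 * b2 + a3 * b3"
    "a1 * b3 + a2 * b2 + a3 * b1 < a1 * b1 + a2 * b2 + a3 * b3"
proof -
  have a13: "a1 < a3" and b13: "b1 < b3" using assms by auto
  note u = uncross_less
  show "a1 * b2 + a2 * b3 + a3 * b1 < a1 * b1 + a2 * b2 + a3 * b3"
    using u[OF assms(2) b13] u[OF assms(1,3)] by linarith
  show "a1 * b3 + a2 * b1 + a3 * b2 < a1 * b1 + a2 * b2 + a3 * b3"
    using u[OF a13 assms(4)] u[OF assms(1) assms(3)] by linarith
  show "a1 * b1 + a2 * b3 + a3 * b2 < a1 * b1 + a2 * b2 + a3 * b3"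
    using u[OF assms(2,4)] by linarith
  show "a1 * b2 + a2 * b1 + a3 * b3 < a1 * b1 + a2 * b2 + a3 * b3"
    using u[OF assms(1,3)] by linarith
  show "a1 * b3 + a2 * b2 + a3 * b1 < a1 * b1 + a2 * b2 + a3 * b3"
    using u[OF a13 b13] by linarith
qed

context vertex_order
begin

abbreviation "unit v \<equiv> Poly_Mapping.single v (1::nat)"

lemma lookup_plus_unit: "Poly_Mapping.lookup (t + unit v) = (\<lambda>w. Poly_Mapping.lookup t w + unit_at v w)"
  by (auto simp: lookup_add lookup_single unit_at_def fun_eq_iff when_def)

lemma weight_plus_edge:
  "weight (Poly_Mapping.lookup (t + unit (edge i c))) = weight (Poly_Mapping.lookup t) + idx (Inl i) * idx c"
  unfolding lookup_plus_unit weight_add weight_unit_at lo_hi_edge ..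

text \<open>Congruent modulo \<open>I\<close> to a combination of monomials without a chain of three edges.\<close>

definition reducible :: "('m, 'n) coeff_var rpoly set \<Rightarrow> ('m, 'n) coeff_var rpoly \<Rightarrow> bool" where
  "reducible I f \<longleftrightarrow> (\<exists>g. f - g \<in> I \<and> (\<forall>t\<in>Poly_Mapping.keys g. three_chain_free (Poly_Mapping.lookup t)))"

lemma reducible_add:
  assumes I: "poly_ideal I" and "reducible I f" "reducible I f'"
  shows "reducible I (f + f')"
proof -
  obtain g where g: "f - g \<in> I" "\<forall>t\<in>Poly_Mapping.keys g. three_chain_free (Poly_Mapping.lookup t)"
    using assms(2) unfolding reducible_def by blast
  obtain g' where g': "f' - g' \<in> I" "\<forall>t\<in>Poly_Mapping.keys g'. three_chain_free (Poly_Mapping.lookup t)"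
    using assms(3) unfolding reducible_def by blast
  have eq: "f + f' - (g + g') = (f - g) + (f' - g')" by simp
  have "f + f' - (g + g') \<in> I" unfolding eq by (rule poly_idealD(2)[OF I g(1) g'(1)])
  then show ?thesis unfolding reducible_def
    using g(2) g'(2) keys_add[of g g'] by (intro exI[of _ "g + g'"]) blast
qed

lemma reducible_mem:
  assumes "f \<in> I" shows "reducible I f"
  unfolding reducible_def using assms by (intro exI[of _ 0]) simp

text \<open>Three increasing edges of the monomial are the diagonal term of a minor. The other five terms
  of that minor are lighter by the rearrangement inequality, so induction on the weight applies
  to what the minor turns the monomial into.\<close>

lemma reducible_monomial:
  assumes I: "poly_ideal I" and minors: "minors3 coeff_matrix \<subseteq> I"
  shows "reducible I (Poly_Mapping.single t x)"
proof (induction "weight (Poly_Mapping.lookup t)" arbitrary: t x rule: less_induct)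
  case less
  show ?case
  proof (cases "three_chain_free (Poly_Mapping.lookup t)")
    case True
    then show ?thesis unfolding reducible_def using poly_idealD(1)[OF I]
      by (intro exI[of _ "Poly_Mapping.single t x"]) auto
  next
    case False
    then obtain e1 e2 e3 where e: "Poly_Mapping.lookup t e1 \<noteq> 0" "Poly_Mapping.lookup t e2 \<noteq> 0"
        "Poly_Mapping.lookup t e3 \<noteq> 0" and chain: "below e1 e2" "below e2 e3"
      unfolding three_chain_free_def by blast
    have split_unit: "\<exists>t'. t = t' + unit v" if "Poly_Mapping.lookup t v \<noteq> 0" for t and v :: "('m, 'n) coeff_var"
    proof -
      have "t = (t - unit v) + unit v"
        by (rule poly_mapping_eqI) (use that in \<open>auto simp: lookup_add lookup_minus lookup_single when_def\<close>)
      then show ?thesis by blast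
    qed
    have distinct: "e1 \<noteq> e2" "e1 \<noteq> e3" "e2 \<noteq> e3" using chain by (auto simp: below_def)
    obtain t1 where t1: "t = t1 + unit e1" using split_unit[OF e(1)] by blast
    have "Poly_Mapping.lookup t1 e2 \<noteq> 0" using e(2) distinct by (simp add: t1 lookup_add lookup_single)
    then obtain t2 where t2: "t1 = t2 + unit e2" using split_unit by blast
    have "Poly_Mapping.lookup t2 e3 \<noteq> 0" using e(3) distinct by (simp add: t1 t2 lookup_add lookup_single)
    then obtain t0 where t0: "t2 = t0 + unit e3" using split_unit by blast
    define i1 i2 i3 c1 c2 c3 where ic:
      "i1 = row e1" "i2 = row e2" "i3 = row e3" "c1 = col e1" "c2 = col e2" "c3 = col e3"
    have e_eq: "e1 = edge i1 c1" "e2 = edge i2 c2" "e3 = edge i3 c3"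
      unfolding ic by (simp_all only: edge_row_col)
    have rows: "idx (Inl i1) < idx (Inl i2)" "idx (Inl i2) < idx (Inl i3)"
      and cols: "idx c1 < idx c2" "idx c2 < idx c3"
      using chain unfolding below_def lo_def hi_def ic by blast+
    \<comment> \<open>The monomials of the multiple of the minor: columns are matched to the rows \<open>i1\<close>, \<open>i2\<close>, \<open>i3\<close>.\<close>
    define m where "m j1 j2 j3 = t0 + unit (edge i1 j1) + unit (edge i2 j2) + unit (edge i3 j3)" for j1 j2 j3
    have weight_m: "weight (Poly_Mapping.lookup (m j1 j2 j3)) = weight (Poly_Mapping.lookup t0)
        + (idx (Inl i1) * idx j1 + idx (Inl i2) * idx j2 + idx (Inl i3) * idx j3)" for j1 j2 j3
      unfolding m_def weight_plus_edge by (simp only: add.assoc)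
    have t_eq: "t = m c1 c2 c3"
      unfolding m_def t1 t2 t0 e_eq by (simp add: ac_simps)
    define k where "k j1 j2 j3 = entry_coeff i1 j1 * entry_coeff i2 j2 * entry_coeff i3 j3"
      for j1 j2 j3 :: "'n + 'm"
    \<comment> \<open>Normalised so that the diagonal term becomes the given monomial with its coefficient \<open>x\<close>.\<close>
    define y where "y = x / k c1 c2 c3"
    have k_nz: "k c1 c2 c3 \<noteq> 0" by (simp add: k_def)
    define fc :: "'n + 'm \<Rightarrow> 'm + 'n" where "fc c = (case c of Inl j \<Rightarrow> Inr j | Inr l \<Rightarrow> Inl l)" for c
    have fc: "flip_col (fc c) = c" for c by (cases c) (auto simp: fc_def)
    have c_ne: "c1 \<noteq> c2" "c1 \<noteq> c3" "c2 \<noteq> c3" using cols by auto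
    have fc_ne: "fc c1 \<noteq> fc c2" "fc c1 \<noteq> fc c3" "fc c2 \<noteq> fc c3" using c_ne fc by metis+
    have i_ne: "i1 \<noteq> i2" "i1 \<noteq> i3" "i2 \<noteq> i3" using rows by auto
    define D where "D = det (\<chi> s u. coeff_matrix $ triple i1 i2 i3 s $ triple (fc c1) (fc c2) (fc c3) u)"
    have "D \<in> I" unfolding D_def using minors minor_mem_minors3[OF i_ne fc_ne] by blast
    then have "Poly_Mapping.single t0 y * D \<in> I" by (rule poly_idealD(3)[OF I])
    moreover define p where "p j1 j2 j3 = Poly_Mapping.single (m j1 j2 j3) (y * k j1 j2 j3)" for j1 j2 j3
    have monomial_term: "Poly_Mapping.single t0 y * (coeff_matrix $ i1 $ fc j1 * coeff_matrix $ i2 $ fc j2 * coeff_matrix $ i3 $ fc j3)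
        = p j1 j2 j3" for j1 j2 j3
      unfolding p_def coeff_matrix_entry fc mult_single m_def k_def by (simp only: ac_simps)
    have "Poly_Mapping.single t0 y * D = p c1 c2 c3 + p c2 c3 c1 + p c3 c1 c2 - p c1 c3 c2 - p c2 c1 c3 - p c3 c2 c1"
      unfolding monomial_term[symmetric] D_def det_3 by (simp add: algebra_simps)
    ultimately have inI: "p c1 c2 c3 + p c2 c3 c1 + p c3 c1 c2 - p c1 c3 c2 - p c2 c1 c3 - p c3 c2 c1 \<in> I"
      by simp
    have red: "reducible I (Poly_Mapping.single (m j1 j2 j3) z)"
      if "idx (Inl i1) * idx j1 + idx (Inl i2) * idx j2 + idx (Inl i3) * idx j3
        < idx (Inl i1) * idx c1 + idx (Inl i2) * idx c2 + idx (Inl i3) * idx c3" for j1 j2 j3 z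
      by (rule less.hyps) (use that in \<open>simp add: t_eq weight_m\<close>)
    have p_red: "reducible I (p j1 j2 j3)" "reducible I (- p j1 j2 j3)"
      if "idx (Inl i1) * idx j1 + idx (Inl i2) * idx j2 + idx (Inl i3) * idx j3
        < idx (Inl i1) * idx c1 + idx (Inl i2) * idx c2 + idx (Inl i3) * idx c3" for j1 j2 j3
      unfolding p_def single_uminus[symmetric] by (rule red[OF that])+
    note small = rearrangement3[OF rows cols]
    have "Poly_Mapping.single t x = p c1 c2 c3"
      using k_nz by (simp add: p_def t_eq y_def)
    also have "\<dots> = (p c1 c2 c3 + p c2 c3 c1 + p c3 c1 c2 - p c1 c3 c2 - p c2 c1 c3 - p c3 c2 c1)
        + (- p c2 c3 c1 + (- p c3 c1 c2 + (p c1 c3 c2 + (p c2 c1 c3 + p c3 c2 c1))))"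
      by simp
    finally have eq: "Poly_Mapping.single t x = \<dots>" .
    have "reducible I (p c2 c1 c3 + p c3 c2 c1)"
      by (rule reducible_add[OF I p_red(1)[OF small(4)] p_red(1)[OF small(5)]])
    note reducible_add[OF I p_red(1)[OF small(3)] this]
    note reducible_add[OF I p_red(2)[OF small(2)] this]
    note reducible_add[OF I p_red(2)[OF small(1)] this]
    note reducible_add[OF I reducible_mem[OF inI] this]
    then show ?thesis unfolding eq .
  qed
qed

lemma reducible_all:
  assumes I: "poly_ideal I" and minors: "minors3 coeff_matrix \<subseteq> I"
  shows "reducible I f"
proof -
  have "reducible I (\<Sum>t\<in>A. Poly_Mapping.single t (h t))" if "finite A" for A and h :: "_ \<Rightarrow> real"
    using that
  proof (induction A rule: finite_induct)
    case empty
    show ?case using reducible_mem[OF poly_idealD(1)[OF I]] by simp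
  next
    case (insert t A)
    show ?case
      unfolding sum.insert[OF insert.hyps]
      by (rule reducible_add[OF I reducible_monomial[OF I minors] insert.IH])
  qed
  from this[of "Poly_Mapping.keys f" "Poly_Mapping.lookup f"] show ?thesis
    by (simp add: poly_mapping_sum_monomials)
qed

end

section \<open>The network as a function of its parameters\<close>

text \<open>The parameters regrouped by vertices: \<open>x\<close> holds the first row of \<open>W\<^sub>1\<close> and the first column
  of \<open>W\<^sub>2\<close>, and \<open>y\<close> the second ones. Numerators and denominator then obey the same formula.\<close>

definition net :: "('n::finite + 'm::finite \<Rightarrow> real) \<Rightarrow> ('n + 'm \<Rightarrow> real) \<Rightarrow> ('m, 'n) coeff_var \<Rightarrow> real" where
  "net x y = network_coeffs (\<chi> a i. if a = 1 then x (Inl i) else y (Inl i))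
     (\<chi> k a. if a = 1 then x (Inr k) else y (Inr k))"

lemma net_edge: "net x y (edge i c) = (x (Inl i) * y c + y (Inl i) * x c) / entry_coeff i c"
proof (cases c)
  case (Inl j)
  show ?thesis
  proof (cases "i = j")
    case True
    then show ?thesis
      by (simp add: Inl net_def network_coeffs_diag entry_coeff_def)
  next
    case False
    then show ?thesis
      by (simp add: Inl net_def network_coeffs_offdiag[OF False] entry_coeff_def del: network_coeffs.simps)
  qed
next
  case (Inr k)
  then show ?thesis by (simp add: net_def entry_coeff_def)
qed

lemma neuromanifold_eq: "(neuromanifold :: (('m::finite, 'n::finite) coeff_var \<Rightarrow> real) set) = {net x y | x y. True}"
proof
  show "{net x y | x y. True} \<subseteq> (neuromanifold :: (('m, 'n) coeff_var \<Rightarrow> real) set)"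
    unfolding neuromanifold_def net_def by blast
  show "(neuromanifold :: (('m, 'n) coeff_var \<Rightarrow> real) set) \<subseteq> {net x y | x y. True}"
  proof
    fix p :: "('m, 'n) coeff_var \<Rightarrow> real"
    assume "p \<in> neuromanifold"
    then obtain W1 :: "real^'n^2" and W2 :: "real^2^'m" where p: "p = network_coeffs W1 W2"
      unfolding neuromanifold_def by blast
    define x where "x = case_sum (\<lambda>i. W1 $ 1 $ i) (\<lambda>k. W2 $ k $ 1)"
    define y where "y = case_sum (\<lambda>i. W1 $ 2 $ i) (\<lambda>k. W2 $ k $ 2)"
    have W1: "(\<chi> a i. if a = 1 then x (Inl i) else y (Inl i)) = W1"
      by (simp add: vec_eq_iff x_def y_def forall_2)
    have W2: "(\<chi> k a. if a = 1 then x (Inr k) else y (Inr k)) = W2"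
      by (simp add: vec_eq_iff x_def y_def forall_2)
    have "p = net x y" unfolding net_def W1 W2 by (rule p)
    then show "p \<in> {net x y | x y. True}" by blast
  qed
qed

lemma network_ideal_eq: "network_ideal = {f. \<forall>x y. peval (net x y) f = 0}"
  unfolding network_ideal_def neurovariety_def vanishing_ideal_zariski_closure
  unfolding vanishing_ideal_def neuromanifold_eq by blast

lemma poly_ideal_network: "poly_ideal network_ideal"
  unfolding network_ideal_def by (rule poly_ideal_vanishing)

text \<open>The matrix with entries \<open>x\<^sub>i y\<^sub>c + y\<^sub>i x\<^sub>c\<close> is a sum of two matrices of rank one.\<close>

lemma minors_vanish: "minors3 coeff_matrix \<subseteq> (network_ideal :: ('m::finite, 'n::finite) coeff_var rpoly set)"
proof
  fix D :: "('m, 'n) coeff_var rpoly"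
  assume "D \<in> minors3 coeff_matrix"
  then obtain r :: "3 \<Rightarrow> 'n" and c :: "3 \<Rightarrow> 'm + 'n" where D: "D = det (\<chi> s t. coeff_matrix $ r s $ c t)"
    unfolding minors3_def by blast
  have "peval (net x y) D = 0" for x y
  proof -
    have entry: "peval (net x y) (coeff_matrix $ i $ c)
        = x (Inl i) * y (flip_col c) + y (Inl i) * x (flip_col c)" for i and c :: "'m + 'n"
    proof -
      have "eval_monom (net x y) (Poly_Mapping.single v 1) = net x y v" for v
        using peval_pvar[of "net x y" v] unfolding pvar_def peval_single by simp
      then show ?thesis
        unfolding coeff_matrix_entry peval_single by (simp only: net_edge) simp
    qed
    show ?thesis
      unfolding D det_3 by (simp add: entry) (simp add: algebra_simps)
  qed
  then show "D \<in> network_ideal" by (simp add: network_ideal_eq)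
qed

section \<open>Reduced polynomials vanishing on the network\<close>

text \<open>The monomial in the variables \<open>fst p\<close> and \<open>snd p\<close> with exponents \<open>fst k\<close> and \<open>snd k\<close>. In this
  section the two groups of variables are \<open>s\<close> and \<open>t\<close>, and later \<open>x\<close> and \<open>y\<close>.\<close>

definition toric_char :: "('a::finite \<Rightarrow> nat) \<times> ('a \<Rightarrow> nat) \<Rightarrow> ('a \<Rightarrow> real) \<times> ('a \<Rightarrow> real) \<Rightarrow> real" where
  "toric_char k p = (\<Prod>a\<in>UNIV. fst p a ^ fst k a) * (\<Prod>a\<in>UNIV. snd p a ^ snd k a)"

lemma toric_chars_independent:
  fixes c :: "('b::finite \<Rightarrow> nat) \<times> ('b \<Rightarrow> nat) \<Rightarrow> real"
  assumes "finite K" "\<And>p. (\<Sum>k\<in>K. c k * toric_char k p) = 0" "k \<in> K"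
  shows "c k = 0"
proof (rule characters_independent[where ch = toric_char and e = "(\<lambda>_. 1, \<lambda>_. 1)" and K = K
      and m = "\<lambda>p q. (\<lambda>a. fst p a * fst q a, \<lambda>a. snd p a * snd q a)"])
  fix k p q
  show "toric_char k (\<lambda>a. fst p a * fst q a, \<lambda>a. snd p a * snd q a) = toric_char k p * toric_char k q"
    by (simp add: toric_char_def power_mult_distrib prod.distrib)
next
  fix k l :: "('b \<Rightarrow> nat) \<times> ('b \<Rightarrow> nat)"
  assume "k \<noteq> l"
  have pick: "(\<Prod>b\<in>UNIV. (if b = a then 2 else 1) ^ A b) = (2::real) ^ A a" for a :: "'b" and A :: "_ \<Rightarrow> nat"
  proof -
    have "(\<Prod>b\<in>UNIV. (if b = a then 2 else 1) ^ A b) = (\<Prod>b\<in>UNIV. if b = a then (2::real) ^ A b else 1)"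
      by (rule prod.cong) auto
    then show ?thesis by (simp add: prod.delta)
  qed
  from \<open>k \<noteq> l\<close> consider a where "fst k a \<noteq> fst l a" | a where "snd k a \<noteq> snd l a"
    by (metis prod_eqI ext)
  then show "\<exists>p. toric_char k p \<noteq> toric_char l p"
  proof cases
    case 1
    then have "toric_char k (\<lambda>b. if b = a then 2 else 1, \<lambda>_. 1) \<noteq> toric_char l (\<lambda>b. if b = a then 2 else 1, \<lambda>_. 1)"
      by (simp add: toric_char_def pick)
    then show ?thesis by blast
  next
    case 2
    then have "toric_char k (\<lambda>_. 1, \<lambda>b. if b = a then 2 else 1) \<noteq> toric_char l (\<lambda>_. 1, \<lambda>b. if b = a then 2 else 1)"
      by (simp add: toric_char_def pick)
    then show ?thesis by blast
  qed
qed (use assms in \<open>simp_all add: toric_char_def\<close>)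

lemma prod_unit_powers:
  fixes s :: "'a::finite \<Rightarrow> real"
  shows "(\<Prod>a\<in>UNIV. s a ^ of_bool (a = b)) = s b"
proof -
  have "(\<Prod>a\<in>UNIV. s a ^ of_bool (a = b)) = (\<Prod>a\<in>UNIV. if a = b then s a else 1)"
    by (rule prod.cong) auto
  then show ?thesis by (simp add: prod.delta)
qed

context vertex_order
begin

lemma prod_powers_vertex_degrees:
  fixes s :: "'n + 'm \<Rightarrow> real"
  shows "(\<Prod>v\<in>UNIV. (s (Inl (row v)) * s (col v)) ^ \<mu> v) = (\<Prod>a\<in>UNIV. s a ^ vertex_degrees \<mu> a)"
proof -
  have inc: "(\<Prod>a\<in>UNIV. s a ^ incidence v a) = s (Inl (row v)) * s (col v)" for v
  proof -
    show ?thesis unfolding incidence_def power_add prod.distrib prod_unit_powers ..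
  qed
  have "(\<Prod>a\<in>UNIV. s a ^ vertex_degrees \<mu> a) = (\<Prod>a\<in>UNIV. \<Prod>v\<in>UNIV. (s a ^ incidence v a) ^ \<mu> v)"
    unfolding vertex_degrees_def power_sum by (simp only: power_mult[symmetric] mult.commute)
  also have "\<dots> = (\<Prod>v\<in>UNIV. \<Prod>a\<in>UNIV. (s a ^ incidence v a) ^ \<mu> v)"
    by (rule prod.swap)
  also have "\<dots> = (\<Prod>v\<in>UNIV. (s (Inl (row v)) * s (col v)) ^ \<mu> v)"
    unfolding prod_power_distrib[symmetric] inc ..
  finally show ?thesis ..
qed

definition edge_scale :: "('m, 'n) coeff_var \<Rightarrow> real" where
  "edge_scale v = 2 / entry_coeff (row v) (col v)"

text \<open>The hyperbolic form \<open>x\<^sub>a y\<^sub>b + y\<^sub>a x\<^sub>b\<close> is diagonalised over the reals. The minus sign is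
  harmless, as no two contributions will ever be added up below.\<close>

lemma net_diagonalised:
  "net (\<lambda>a. s a + t a) (\<lambda>a. s a - t a) v
    = edge_scale v * (s (Inl (row v)) * s (col v) - t (Inl (row v)) * t (col v))"
proof -
  have "net (\<lambda>a. s a + t a) (\<lambda>a. s a - t a) (edge (row v) (col v))
    = edge_scale v * (s (Inl (row v)) * s (col v) - t (Inl (row v)) * t (col v))"
    unfolding net_edge edge_scale_def by (simp add: algebra_simps add_divide_distrib diff_divide_distrib)
  then show ?thesis unfolding edge_row_col .
qed

text \<open>The coefficient with which the monomial \<open>\<mu>\<close> of the coefficient variables contributes the
  splitting into \<open>\<nu>\<close>, evaluated at \<open>s\<close>, and \<open>\<mu> - \<nu>\<close>, evaluated at \<open>t\<close>. That binomial
  coefficients are nonzero in characteristic 0 is what makes the join argument work.\<close>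

definition split_coeff :: "(('m, 'n) coeff_var \<Rightarrow> nat) \<Rightarrow> (('m, 'n) coeff_var \<Rightarrow> nat) \<Rightarrow> real" where
  "split_coeff \<mu> \<nu> = (\<Prod>v\<in>UNIV. edge_scale v ^ \<mu> v * (real (\<mu> v choose \<nu> v) * (- 1) ^ (\<mu> v - \<nu> v)))"

lemma split_coeff_nonzero:
  assumes "\<And>v. \<nu> v \<le> \<mu> v"
  shows "split_coeff \<mu> \<nu> \<noteq> 0"
  unfolding split_coeff_def using assms by (simp add: finite_coeff_var edge_scale_def not_less)

lemma eval_monom_net:
  "eval_monom (net (\<lambda>a. fst p a + snd p a) (\<lambda>a. fst p a - snd p a)) t
    = (\<Sum>\<nu>\<in>PiE UNIV (\<lambda>v. {..Poly_Mapping.lookup t v}). split_coeff (Poly_Mapping.lookup t) \<nu>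
        * toric_char (vertex_degrees \<nu>, vertex_degrees (\<lambda>v. Poly_Mapping.lookup t v - \<nu> v)) p)"
proof -
  define \<mu> where "\<mu> = Poly_Mapping.lookup t"
  define S where "S s v = s (Inl (row v)) * s (col v)" for s :: "'n + 'm \<Rightarrow> real" and v
  have binomial_expansion: "(edge_scale v * (S (fst p) v - S (snd p) v)) ^ n = (\<Sum>j\<in>{..n}.
      (edge_scale v ^ n * (real (n choose j) * (- 1) ^ (n - j))) * (S (fst p) v ^ j * S (snd p) v ^ (n - j)))" for v n
  proof -
    have "(S (fst p) v + (- 1) * S (snd p) v) ^ n
        = (\<Sum>j\<le>n. of_nat (n choose j) * S (fst p) v ^ j * ((- 1) * S (snd p) v) ^ (n - j))"
      by (rule binomial_ring)
    then have "(edge_scale v * (S (fst p) v - S (snd p) v)) ^ n = edge_scale v ^ n *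
        (\<Sum>j\<le>n. of_nat (n choose j) * S (fst p) v ^ j * ((- 1) * S (snd p) v) ^ (n - j))"
      unfolding power_mult_distrib by simp
    also have "\<dots> = (\<Sum>j\<in>{..n}.
      (edge_scale v ^ n * (real (n choose j) * (- 1) ^ (n - j))) * (S (fst p) v ^ j * S (snd p) v ^ (n - j)))"
      unfolding sum_distrib_left by (intro sum.cong refl) (simp only: power_mult_distrib ac_simps)
    finally show ?thesis .
  qed
  have "eval_monom (net (\<lambda>a. fst p a + snd p a) (\<lambda>a. fst p a - snd p a)) t
      = (\<Prod>v\<in>UNIV. (edge_scale v * (S (fst p) v - S (snd p) v)) ^ \<mu> v)"
    unfolding \<mu>_def S_def
    by (subst eval_monom_superset[OF finite_coeff_var subset_UNIV]) (simp only: net_diagonalised)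
  also have "\<dots> = (\<Sum>\<nu>\<in>PiE UNIV (\<lambda>v. {..\<mu> v}). \<Prod>v\<in>UNIV.
      (edge_scale v ^ \<mu> v * (real (\<mu> v choose \<nu> v) * (- 1) ^ (\<mu> v - \<nu> v))) * (S (fst p) v ^ \<nu> v * S (snd p) v ^ (\<mu> v - \<nu> v)))"
    unfolding binomial_expansion by (rule prod_sum_PiE) (auto simp: finite_coeff_var)
  also have "\<dots> = (\<Sum>\<nu>\<in>PiE UNIV (\<lambda>v. {..\<mu> v}). split_coeff \<mu> \<nu> * toric_char (vertex_degrees \<nu>, vertex_degrees (\<lambda>v. \<mu> v - \<nu> v)) p)"
  proof (intro sum.cong refl)
    fix \<nu> :: "('m, 'n) coeff_var \<Rightarrow> nat"
    have "toric_char (vertex_degrees \<nu>, vertex_degrees (\<lambda>v. \<mu> v - \<nu> v)) p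
        = (\<Prod>v\<in>UNIV. S (fst p) v ^ \<nu> v) * (\<Prod>v\<in>UNIV. S (snd p) v ^ (\<mu> v - \<nu> v))"
      unfolding toric_char_def S_def prod_powers_vertex_degrees[of _ \<nu>] prod_powers_vertex_degrees[of _ "\<lambda>v. \<mu> v - \<nu> v"] by simp
    then show "(\<Prod>v\<in>UNIV. (edge_scale v ^ \<mu> v * (real (\<mu> v choose \<nu> v) * (- 1) ^ (\<mu> v - \<nu> v))) * (S (fst p) v ^ \<nu> v * S (snd p) v ^ (\<mu> v - \<nu> v)))
        = split_coeff \<mu> \<nu> * toric_char (vertex_degrees \<nu>, vertex_degrees (\<lambda>v. \<mu> v - \<nu> v)) p"
      unfolding split_coeff_def by (simp only: prod.distrib)
  qed
  finally show ?thesis unfolding \<mu>_def .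
qed

text \<open>A heaviest monomial \<open>m\<close> of \<open>f\<close> splits into two nested monomials. Any splitting of a monomial
  of \<open>f\<close> with the same pair of vertex degrees weighs at least as much in both parts, by
  minimality, and not more in total, by the choice of \<open>m\<close>. So both parts coincide with those of
  \<open>m\<close>, and the coefficient of \<open>m\<close> in \<open>f\<close> can be read off.\<close>

lemma reduced_vanishing_eq_0:
  assumes red: "\<And>t. t \<in> Poly_Mapping.keys f \<Longrightarrow> three_chain_free (Poly_Mapping.lookup t)"
    and vanish: "f \<in> network_ideal"
  shows "f = 0"
proof (rule ccontr)
  assume "f \<noteq> 0"
  let ?W = "\<lambda>t. weight (Poly_Mapping.lookup t)"
  let ?B = "\<lambda>t. PiE UNIV (\<lambda>v. {..Poly_Mapping.lookup t v})"
  have ne: "Poly_Mapping.keys f \<noteq> {}" using \<open>f \<noteq> 0\<close> by simp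
  have "Max (?W ` Poly_Mapping.keys f) \<in> ?W ` Poly_Mapping.keys f"
    using ne by (intro Max_in) auto
  then obtain m where m: "m \<in> Poly_Mapping.keys f" and W_m: "Max (?W ` Poly_Mapping.keys f) = ?W m"
    by blast
  have max: "?W t \<le> ?W m" if "t \<in> Poly_Mapping.keys f" for t
    unfolding W_m[symmetric] using that by (intro Max_ge) auto
  obtain \<nu>0 where \<nu>0: "\<And>v. \<nu>0 v \<le> Poly_Mapping.lookup m v" "nested \<nu>0" "nested (\<lambda>v. Poly_Mapping.lookup m v - \<nu>0 v)"
    using three_chain_free_split[OF red[OF m]] by metis
  \<comment> \<open>All splittings of monomials of \<open>f\<close>; \<open>key\<close> is the resulting monomial in \<open>s\<close> and \<open>t\<close>.\<close>
  define P where "P = Sigma (Poly_Mapping.keys f) ?B"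
  define key where "key q = (vertex_degrees (snd q), vertex_degrees (\<lambda>v. Poly_Mapping.lookup (fst q) v - snd q v))"
    for q :: "(('m, 'n) coeff_var \<Rightarrow>\<^sub>0 nat) \<times> (('m, 'n) coeff_var \<Rightarrow> nat)"
  define cf where "cf q = Poly_Mapping.lookup f (fst q) * split_coeff (Poly_Mapping.lookup (fst q)) (snd q)" for q
  have finP: "finite P" unfolding P_def
    by (intro finite_SigmaI finite_PiE finite_coeff_var) auto
  have "(\<Sum>k\<in>key ` P. (\<Sum>q | q \<in> P \<and> key q = k. cf q) * toric_char k p) = 0" for p
  proof -
    have "0 = peval (net (\<lambda>a. fst p a + snd p a) (\<lambda>a. fst p a - snd p a)) f"
      using vanish by (simp add: network_ideal_eq)
    also have "\<dots> = (\<Sum>t\<in>Poly_Mapping.keys f. \<Sum>\<nu>\<in>?B t. cf (t, \<nu>) * toric_char (key (t, \<nu>)) p)"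
      unfolding peval_eq eval_monom_net cf_def key_def by (simp add: sum_distrib_left mult.assoc)
    also have "\<dots> = (\<Sum>q\<in>P. cf q * toric_char (key q) p)"
      unfolding P_def by (subst sum.Sigma) (auto intro!: finite_PiE finite_coeff_var simp: case_prod_beta)
    also have "\<dots> = (\<Sum>k\<in>key ` P. \<Sum>q | q \<in> P \<and> key q = k. cf q * toric_char (key q) p)"
      by (rule sum.image_gen[OF finP])
    also have "\<dots> = (\<Sum>k\<in>key ` P. (\<Sum>q | q \<in> P \<and> key q = k. cf q) * toric_char k p)"
      by (simp add: sum_distrib_right)
    finally show ?thesis ..
  qed
  moreover have mP: "(m, \<nu>0) \<in> P" unfolding P_def using m \<nu>0(1) by (simp add: PiE_UNIV_domain)
  ultimately have "(\<Sum>q | q \<in> P \<and> key q = key (m, \<nu>0). cf q) = 0"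
    by (intro toric_chars_independent[where c = "\<lambda>k. \<Sum>q | q \<in> P \<and> key q = k. cf q" and K = "key ` P"])
      (use finP in auto)
  moreover have "{q. q \<in> P \<and> key q = key (m, \<nu>0)} = {(m, \<nu>0)}"
  proof (intro equalityI subsetI)
    fix q assume "q \<in> {q. q \<in> P \<and> key q = key (m, \<nu>0)}"
    then obtain t \<nu> where q: "q = (t, \<nu>)" and t: "t \<in> Poly_Mapping.keys f"
      and \<nu>: "\<And>v. \<nu> v \<le> Poly_Mapping.lookup t v"
      and key_eq: "key (t, \<nu>) = key (m, \<nu>0)"
      unfolding P_def by (cases q) (auto simp: PiE_UNIV_domain)
    let ?\<nu>' = "\<lambda>v. Poly_Mapping.lookup t v - \<nu> v" and ?\<nu>0' = "\<lambda>v. Poly_Mapping.lookup m v - \<nu>0 v"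
    have d: "vertex_degrees \<nu> = vertex_degrees \<nu>0" "vertex_degrees ?\<nu>' = vertex_degrees ?\<nu>0'" using key_eq by (simp_all add: key_def)
    have sum_t: "Poly_Mapping.lookup t = (\<lambda>v. \<nu> v + ?\<nu>' v)" and sum_m: "Poly_Mapping.lookup m = (\<lambda>v. \<nu>0 v + ?\<nu>0' v)"
      using \<nu> \<nu>0(1) by simp_all
    have "weight \<nu> + weight ?\<nu>' \<le> weight \<nu>0 + weight ?\<nu>0'"
      using max[OF t] by (subst (asm) sum_t, subst (asm) sum_m) (simp only: weight_add)
    then have eq: "\<nu> = \<nu>0" "?\<nu>' = ?\<nu>0'"
      using nested_minimal[OF \<nu>0(2) d(1)] nested_minimal[OF \<nu>0(3) d(2)] by linarith+
    have "Poly_Mapping.lookup t v = Poly_Mapping.lookup m v" for v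
      using fun_cong[OF eq(1), of v] fun_cong[OF eq(2), of v] \<nu>[of v] \<nu>0(1)[of v] by arith
    then have "t = m" by (rule poly_mapping_eqI)
    then show "q \<in> {(m, \<nu>0)}" unfolding q eq(1) by blast
  qed (use mP in simp)
  ultimately have "cf (m, \<nu>0) = 0" by simp
  then show False
    using m split_coeff_nonzero[of \<nu>0 "Poly_Mapping.lookup m", OF \<nu>0(1)] unfolding cf_def by (simp add: in_keys_iff)
qed

end

text \<open>Modulo the minors a polynomial of the network ideal becomes reduced. It stays in the network
  ideal, which contains the minors, and hence it becomes zero.\<close>

theorem network_ideal_eq_genideal:
  "(network_ideal :: ('m::finite, 'n::finite) coeff_var rpoly set) = genideal rpoly_ring (minors3 coeff_matrix)"
    (is "?N = ?I")
proof
  show "?I \<subseteq> ?N" by (rule genideal_least[OF poly_ideal_network minors_vanish])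
  obtain idx :: "'n + 'm \<Rightarrow> nat" where "vertex_order idx" using exists_vertex_order by blast
  then interpret vertex_order idx .
  show "?N \<subseteq> ?I"
  proof
    fix f assume f: "f \<in> ?N"
    obtain g where g: "f - g \<in> ?I" "\<And>t. t \<in> Poly_Mapping.keys g \<Longrightarrow> three_chain_free (Poly_Mapping.lookup t)"
      using reducible_all[OF poly_ideal_genideal genideal_superset] unfolding reducible_def by blast
    have "f - (f - g) \<in> ?N"
      using f g(1) \<open>?I \<subseteq> ?N\<close> by (blast intro: poly_idealD(5)[OF poly_ideal_network])
    then have "g = 0" using reduced_vanishing_eq_0[OF g(2)] by simp
    then show "f \<in> ?I" using g(1) by simp
  qed
qed

section \<open>Chains of prime ideals\<close>

definition prime_poly_ideal :: "'v rpoly set \<Rightarrow> bool" where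
  "prime_poly_ideal P \<longleftrightarrow> poly_ideal P \<and> 1 \<notin> P \<and> (\<forall>f g. f * g \<in> P \<longrightarrow> f \<in> P \<or> g \<in> P)"

text \<open>This and the next two lemmas translate primes of the quotient into primes containing the
  ideal, so that chains can be treated in the polynomial ring itself.\<close>

lemma primeideal_Quot_preimage:
  assumes I: "poly_ideal I" and P: "primeideal P ((rpoly_ring :: 'v rpoly ring) Quot I)"
  defines "Q \<equiv> {f. I +>\<^bsub>rpoly_ring\<^esub> f \<in> P}"
  shows "prime_poly_ideal Q" "I \<subseteq> Q"
proof -
  let ?R = "rpoly_ring :: 'v rpoly ring"
  interpret I: ideal I ?R using I by (simp add: ideal_iff_poly_ideal)
  have "primeideal {r \<in> carrier ?R. I +>\<^bsub>?R\<^esub> r \<in> P} ?R"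
    by (rule ring_hom_ring.primeideal_vimage[OF I.rcos_ring_hom_ring cring_rpoly P])
  then have Q: "primeideal Q ?R" unfolding Q_def by simp
  interpret Q: primeideal Q ?R by (rule Q)
  have pQ: "poly_ideal Q" using Q.is_ideal by (simp add: ideal_iff_poly_ideal)
  have "1 \<notin> Q"
  proof
    assume "1 \<in> Q"
    then have "f \<in> Q" for f using poly_idealD(3)[OF pQ, of 1 f] by simp
    then show False using Q.I_notcarr by auto
  qed
  then show "prime_poly_ideal Q"
    unfolding prime_poly_ideal_def using pQ Q.I_prime by simp
  interpret P: primeideal P "?R Quot I" by (rule P)
  have zero: "I \<in> P"
    using additive_subgroup.zero_closed[OF P.is_additive_subgroup] by (simp add: FactRing_def)
  show "I \<subseteq> Q"
  proof
    fix f assume "f \<in> I"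
    then have "I +>\<^bsub>?R\<^esub> f = I" using I.a_rcos_const by blast
    then show "f \<in> Q" using zero by (simp add: Q_def)
  qed
qed

lemma coset_mem_image_iff:
  assumes P: "poly_ideal P" and "I \<subseteq> P" and I: "poly_ideal I"
  shows "I +>\<^bsub>(rpoly_ring :: 'v rpoly ring)\<^esub> f \<in> (+>\<^bsub>rpoly_ring\<^esub>) I ` P \<longleftrightarrow> f \<in> P"
proof
  assume "I +>\<^bsub>(rpoly_ring :: 'v rpoly ring)\<^esub> f \<in> (+>\<^bsub>rpoly_ring\<^esub>) I ` P"
  then obtain g where g: "g \<in> P" "I +>\<^bsub>(rpoly_ring :: 'v rpoly ring)\<^esub> f = I +>\<^bsub>rpoly_ring\<^esub> g"
    by blast
  have coset: "I +>\<^bsub>(rpoly_ring :: 'v rpoly ring)\<^esub> h = {i + h | i. i \<in> I}" for h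
    by (auto simp: a_r_coset_def')
  have "f \<in> {i + f | i. i \<in> I}" using poly_idealD(1)[OF I] by force
  then have "f \<in> {i + g | i. i \<in> I}" using g(2) unfolding coset by simp
  then obtain i where "i \<in> I" "f = i + g" by blast
  then show "f \<in> P" using assms(2) g(1) poly_idealD(2)[OF P] by blast
qed blast

lemma primeideal_Quot_image:
  assumes I: "poly_ideal I" and P: "prime_poly_ideal P" and sub: "I \<subseteq> P"
  shows "primeideal ((+>\<^bsub>rpoly_ring\<^esub>) I ` P) ((rpoly_ring :: 'v rpoly ring) Quot I)"
proof -
  let ?R = "rpoly_ring :: 'v rpoly ring"
  interpret I: ideal I ?R using I by (simp add: ideal_iff_poly_ideal)
  have pP: "poly_ideal P" using P by (simp add: prime_poly_ideal_def)
  note mem = coset_mem_image_iff[OF pP sub I]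
  have carr: "carrier (?R Quot I) = range (\<lambda>f. I +>\<^bsub>?R\<^esub> f)"
    by (auto simp: FactRing_def A_RCOSETS_def')
  show ?thesis
  proof (rule primeidealI)
    show "ideal ((+>\<^bsub>?R\<^esub>) I ` P) (?R Quot I)"
      using pP I by (intro ring.ring_ideal_imp_quot_ideal[OF ring_rpoly]) (simp_all add: ideal_iff_poly_ideal)
    show "cring (?R Quot I)" by (rule I.quotient_is_cring[OF cring_rpoly])
    have "1 \<notin> P" using P by (simp add: prime_poly_ideal_def)
    then show "carrier (?R Quot I) \<noteq> (+>\<^bsub>?R\<^esub>) I ` P" using mem[of 1] carr by blast
    fix a b assume ab: "a \<in> carrier (?R Quot I)" "b \<in> carrier (?R Quot I)"
      "a \<otimes>\<^bsub>?R Quot I\<^esub> b \<in> (+>\<^bsub>?R\<^esub>) I ` P"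
    then obtain f g where f: "a = I +>\<^bsub>?R\<^esub> f" and g: "b = I +>\<^bsub>?R\<^esub> g"
      unfolding carr by blast
    have "a \<otimes>\<^bsub>?R Quot I\<^esub> b = I +>\<^bsub>?R\<^esub> (f * g)"
      unfolding f g using I.rcoset_mult_add[of f g] by (simp add: FactRing_def)
    then have "f * g \<in> P" using ab(3) mem by simp
    then have "f \<in> P \<or> g \<in> P" using P by (simp add: prime_poly_ideal_def)
    then show "a \<in> (+>\<^bsub>?R\<^esub>) I ` P \<or> b \<in> (+>\<^bsub>?R\<^esub>) I ` P"
      unfolding f g mem .
  qed
qed

definition prime_chain :: "'v rpoly set \<Rightarrow> nat \<Rightarrow> (nat \<Rightarrow> 'v rpoly set) \<Rightarrow> bool" where
  "prime_chain I k P \<longleftrightarrow> (\<forall>i\<le>k. prime_poly_ideal (P i) \<and> I \<subseteq> P i) \<and> (\<forall>i<k. P i \<subset> P (Suc i))"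

lemma krull_dim_Quot_eq:
  assumes I: "poly_ideal I"
  shows "krull_dim ((rpoly_ring :: 'v rpoly ring) Quot I) = (SUP k\<in>{k. \<exists>P. prime_chain I k P}. enat k)"
proof -
  let ?R = "rpoly_ring :: 'v rpoly ring"
  interpret I: ideal I ?R using I by (simp add: ideal_iff_poly_ideal)
  have carr: "carrier (?R Quot I) = range (\<lambda>f. I +>\<^bsub>?R\<^esub> f)"
    by (auto simp: FactRing_def A_RCOSETS_def')
  have "(\<exists>P. (\<forall>i\<le>k. primeideal (P i) (?R Quot I)) \<and> (\<forall>i<k. P i \<subset> P (Suc i))) \<longleftrightarrow> (\<exists>P. prime_chain I k P)" for k
  proof
    assume "\<exists>P. (\<forall>i\<le>k. primeideal (P i) (?R Quot I)) \<and> (\<forall>i<k. P i \<subset> P (Suc i))"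
    then obtain P where prime: "\<And>i. i \<le> k \<Longrightarrow> primeideal (P i) (?R Quot I)" and strict: "\<And>i. i < k \<Longrightarrow> P i \<subset> P (Suc i)"
      by blast
    define Q where "Q i = {f. I +>\<^bsub>?R\<^esub> f \<in> P i}" for i
    have "Q i \<subset> Q (Suc i)" if i: "i < k" for i
    proof -
      obtain x where x: "x \<in> P (Suc i)" "x \<notin> P i" using strict[OF i] by blast
      interpret P: primeideal "P (Suc i)" "?R Quot I" using prime[of "Suc i"] that by simp
      have "x \<in> carrier (?R Quot I)"
        using additive_subgroup.a_subset[OF P.is_additive_subgroup] x(1) by blast
      then obtain f where "x = I +>\<^bsub>?R\<^esub> f" unfolding carr by blast
      then have "f \<in> Q (Suc i)" "f \<notin> Q i" using x by (simp_all add: Q_def)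
      moreover have "Q i \<subseteq> Q (Suc i)" using strict[OF that] by (auto simp: Q_def)
      ultimately show ?thesis by blast
    qed
    then have "prime_chain I k Q"
      unfolding prime_chain_def Q_def using primeideal_Quot_preimage[OF I prime] by blast
    then show "\<exists>P. prime_chain I k P" by blast
  next
    assume "\<exists>P. prime_chain I k P"
    then obtain P where prime: "\<And>i. i \<le> k \<Longrightarrow> prime_poly_ideal (P i)" "\<And>i. i \<le> k \<Longrightarrow> I \<subseteq> P i"
      and strict: "\<And>i. i < k \<Longrightarrow> P i \<subset> P (Suc i)"
      unfolding prime_chain_def by blast
    define Q where "Q i = (+>\<^bsub>?R\<^esub>) I ` P i" for i
    have "Q i \<subset> Q (Suc i)" if i: "i < k" for i
    proof -
      obtain f where f: "f \<in> P (Suc i)" "f \<notin> P i" using strict[OF i] by blast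
      have "poly_ideal (P i)" "I \<subseteq> P i" using prime[of i] that by (simp_all add: prime_poly_ideal_def)
      then have "I +>\<^bsub>?R\<^esub> f \<notin> Q i" unfolding Q_def using coset_mem_image_iff[OF _ _ I] f(2) by blast
      moreover have "I +>\<^bsub>?R\<^esub> f \<in> Q (Suc i)" unfolding Q_def using f(1) by blast
      moreover have "Q i \<subseteq> Q (Suc i)" using strict[OF that] unfolding Q_def by blast
      ultimately show ?thesis by blast
    qed
    moreover have "primeideal (Q i) (?R Quot I)" if "i \<le> k" for i
      unfolding Q_def by (rule primeideal_Quot_image[OF I prime[OF that]])
    ultimately show "\<exists>P. (\<forall>i\<le>k. primeideal (P i) (?R Quot I)) \<and> (\<forall>i<k. P i \<subset> P (Suc i))" by blast
  qed
  then show ?thesis unfolding krull_dim_def by simp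
qed

section \<open>Algebraic independence modulo an ideal\<close>

text \<open>Families and exponents are lists because a chain of primes produces its independent elements
  one at a time. The second equation is meant for empty lists; it also gives a value for lists
  of different lengths.\<close>

fun power_product :: "'v rpoly list \<Rightarrow> nat list \<Rightarrow> 'v rpoly" where
  "power_product (f # fs) (e # es) = f ^ e * power_product fs es"
| "power_product _ _ = 1"

definition exponents :: "nat \<Rightarrow> nat \<Rightarrow> nat list set" where
  "exponents k s = {es. set es \<subseteq> {..s} \<and> length es = k}"

lemma finite_exponents: "finite (exponents k s)" and card_exponents: "card (exponents k s) = Suc s ^ k"
  unfolding exponents_def using finite_lists_length_eq[of "{..s}" k] card_lists_length_eq[of "{..s}" k] by simp_all

definition alg_combination :: "'v rpoly list \<Rightarrow> nat \<Rightarrow> (nat list \<Rightarrow> real) \<Rightarrow> 'v rpoly" where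
  "alg_combination fs s c = (\<Sum>es\<in>exponents (length fs) s. Poly_Mapping.single 0 (c es) * power_product fs es)"

text \<open>Exponents are bounded by a common \<open>s\<close> instead of running over finite sets: this expresses the
  same independence, and it makes the number of power products a plain power.\<close>

definition alg_independent :: "'v rpoly set \<Rightarrow> 'v rpoly list \<Rightarrow> bool" where
  "alg_independent P fs \<longleftrightarrow>
    (\<forall>s c. alg_combination fs s c \<in> P \<longrightarrow> (\<forall>es\<in>exponents (length fs) s. c es = 0))"

lemma exponents_Suc: "exponents (Suc k) s = (\<lambda>(e, es). e # es) ` ({..s} \<times> exponents k s)"
proof -
  have "es \<in> exponents (Suc k) s \<longleftrightarrow> es \<in> (\<lambda>(e, es). e # es) ` ({..s} \<times> exponents k s)" for es
    by (cases es) (auto simp: exponents_def)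
  then show ?thesis by blast
qed

lemma alg_combination_Cons:
  "alg_combination (f # fs) s c = (\<Sum>e\<le>s. f ^ e * alg_combination fs s (\<lambda>es. c (e # es)))"
proof -
  have "alg_combination (f # fs) s c = (\<Sum>(e, es)\<in>{..s} \<times> exponents (length fs) s.
      Poly_Mapping.single 0 (c (e # es)) * (f ^ e * power_product fs es))"
    unfolding alg_combination_def length_Cons exponents_Suc
    by (subst sum.reindex) (auto simp: inj_on_def case_prod_beta)
  also have "\<dots> = (\<Sum>e\<le>s. \<Sum>es\<in>exponents (length fs) s.
      Poly_Mapping.single 0 (c (e # es)) * (f ^ e * power_product fs es))"
    by (simp add: sum.cartesian_product)
  finally show ?thesis
    unfolding alg_combination_def sum_distrib_left by (simp only: ac_simps)
qed

text \<open>Modulo \<open>Q\<close> only the constant coefficient \<open>G 0\<close> survives, as \<open>f \<in> Q\<close>. Once it is known to be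
  zero, \<open>f\<close> can be cancelled modulo the prime \<open>P\<close>, which lowers the degree.\<close>

lemma power_sum_coeffs_zero:
  assumes P: "prime_poly_ideal P" and "P \<subseteq> Q" "f \<in> Q" "f \<notin> P" and Q: "poly_ideal Q"
    and "(\<Sum>e\<le>s. f ^ e * G e) \<in> P" "\<And>e. e \<le> s \<Longrightarrow> G e \<in> Q \<Longrightarrow> G e = 0"
  shows "\<forall>e\<le>s. G e = 0"
  using assms(6,7)
proof (induction s arbitrary: G)
  case 0
  then show ?case using \<open>P \<subseteq> Q\<close> by auto
next
  case (Suc s)
  have shift: "(\<Sum>e\<le>Suc s. f ^ e * G e) = G 0 + f * (\<Sum>e\<le>s. f ^ e * G (Suc e))"
    unfolding sum.atMost_Suc_shift sum_distrib_left by (simp add: mult.assoc)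
  have "G 0 + f * (\<Sum>e\<le>s. f ^ e * G (Suc e)) \<in> Q" using Suc.prems(1) \<open>P \<subseteq> Q\<close> shift by auto
  moreover have "f * (\<Sum>e\<le>s. f ^ e * G (Suc e)) \<in> Q"
    unfolding mult.commute[of f "\<Sum>e\<le>s. f ^ e * G (Suc e)"] by (rule poly_idealD(3)[OF Q \<open>f \<in> Q\<close>])
  ultimately have "G 0 \<in> Q" using poly_idealD(5)[OF Q] by fastforce
  then have G0: "G 0 = 0" using Suc.prems(2)[of 0] by simp
  then have "f * (\<Sum>e\<le>s. f ^ e * G (Suc e)) \<in> P" using Suc.prems(1) shift by simp
  then have "(\<Sum>e\<le>s. f ^ e * G (Suc e)) \<in> P"
    using P \<open>f \<notin> P\<close> unfolding prime_poly_ideal_def by blast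
  then have "\<forall>e\<le>s. G (Suc e) = 0" by (rule Suc.IH) (use Suc.prems(2) in auto)
  then show ?case using G0 by (metis Suc_le_mono not0_implies_Suc)
qed

text \<open>Expand a relation for the larger family by powers of \<open>f\<close>; its coefficients are relations for
  the smaller one. This is the step that makes the transcendence degree drop along a chain of
  primes.\<close>

lemma alg_independent_Cons:
  assumes P: "prime_poly_ideal P" and "P \<subseteq> Q" "f \<in> Q" "f \<notin> P" and Q: "poly_ideal Q"
    and ind: "alg_independent Q fs"
  shows "alg_independent P (f # fs)"
  unfolding alg_independent_def
proof (intro allI impI ballI)
  fix s c es
  assume rel: "alg_combination (f # fs) s c \<in> P" and es: "es \<in> exponents (length (f # fs)) s"
  let ?G = "\<lambda>e. alg_combination fs s (\<lambda>es. c (e # es))"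
  have coeffs: "c (e # es) = 0" if "?G e \<in> Q" "es \<in> exponents (length fs) s" for e es
    using ind that unfolding alg_independent_def by blast
  have "\<forall>e\<le>s. ?G e = 0"
  proof (rule power_sum_coeffs_zero[OF assms(1-5)])
    show "(\<Sum>e\<le>s. f ^ e * ?G e) \<in> P" using rel by (simp only: alg_combination_Cons)
    fix e assume G: "?G e \<in> Q"
    show "?G e = 0" unfolding alg_combination_def[of _ _ "\<lambda>es. c (e # es)"]
      by (rule sum.neutral) (simp add: coeffs[OF G])
  qed
  then have "c (e # es) = 0" if "e \<le> s" "es \<in> exponents (length fs) s" for e es
    using coeffs that poly_idealD(1)[OF Q] by metis
  then show "c es = 0" using es unfolding length_Cons exponents_Suc by auto
qed

lemma alg_independent_Nil:
  assumes P: "prime_poly_ideal P"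
  shows "alg_independent P []"
proof -
  have pP: "poly_ideal P" and "1 \<notin> P" using P by (simp_all add: prime_poly_ideal_def)
  have "x = 0" if "Poly_Mapping.single 0 x \<in> P" for x
  proof (rule ccontr)
    assume "x \<noteq> 0"
    then have "Poly_Mapping.single 0 (1 / x) * Poly_Mapping.single 0 x = (1 :: 'a rpoly)"
      by (simp add: mult_single)
    then show False using poly_idealD(3)[OF pP that] \<open>1 \<notin> P\<close> by metis
  qed
  moreover have "exponents 0 s = {[]}" for s by (auto simp: exponents_def)
  ultimately show ?thesis by (simp add: alg_independent_def alg_combination_def)
qed

lemma chain_gives_independent:
  assumes "prime_chain I k P"
  shows "\<exists>fs. length fs = k \<and> alg_independent (P 0) fs"
  using assms
proof (induction k arbitrary: P)
  case 0
  then show ?case using alg_independent_Nil by (auto simp: prime_chain_def)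
next
  case (Suc k)
  have "prime_chain I k (\<lambda>i. P (Suc i))" using Suc.prems unfolding prime_chain_def by simp
  then obtain fs where fs: "length fs = k" "alg_independent (P (Suc 0)) fs" using Suc.IH by blast
  have P01: "prime_poly_ideal (P 0)" "prime_poly_ideal (P (Suc 0))" "P 0 \<subset> P (Suc 0)"
    using Suc.prems unfolding prime_chain_def by auto
  then obtain f where "f \<in> P (Suc 0)" "f \<notin> P 0" by blast
  then have "alg_independent (P 0) (f # fs)"
    using P01 fs(2) by (intro alg_independent_Cons[where Q = "P (Suc 0)"]) (auto simp: prime_poly_ideal_def)
  then show ?case using fs(1) by (intro exI[of _ "f # fs"]) simp
qed

lemma alg_independent_antimono:
  assumes "I \<subseteq> P" "alg_independent P fs"
  shows "alg_independent I fs"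
  using assms unfolding alg_independent_def by blast

section \<open>Counting monomials\<close>

text \<open>More vectors \<open>M i\<close> than coordinates \<open>k\<close>: Gaussian elimination.\<close>

lemma nontrivial_relation:
  fixes M :: "'i \<Rightarrow> 'k \<Rightarrow> 'f::field"
  assumes "finite K" "finite I" "card K < card I"
  shows "\<exists>c. (\<exists>i\<in>I. c i \<noteq> 0) \<and> (\<forall>k\<in>K. (\<Sum>i\<in>I. c i * M i k) = 0)"
  using assms
proof (induction K arbitrary: I M rule: finite_induct)
  case empty
  then obtain i where "i \<in> I" by (metis card.empty equals0I less_irrefl)
  then show ?case by (intro exI[of _ "\<lambda>_. 1"]) auto
next
  case (insert k K)
  show ?case
  proof (cases "\<forall>i\<in>I. M i k = 0")
    case True
    have "card K < card I" using insert.prems(2) insert.hyps by simp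
    from insert.IH[OF insert.prems(1) this, of M] obtain c
      where "\<exists>i\<in>I. c i \<noteq> 0" "\<forall>k\<in>K. (\<Sum>i\<in>I. c i * M i k) = 0" by blast
    then show ?thesis using True by (intro exI[of _ c]) simp
  next
    case False
    then obtain i0 where i0: "i0 \<in> I" "M i0 k \<noteq> 0" by blast
    \<comment> \<open>Subtract multiples of row \<open>i0\<close> to clear the coordinate \<open>k\<close>.\<close>
    define M' where "M' i l = M i l - M i k / M i0 k * M i0 l" for i l
    have "card K < card (I - {i0})" using insert.prems insert.hyps i0 by simp
    from insert.IH[OF finite_Diff[OF insert.prems(1)] this, of M'] obtain c
      where c: "\<exists>i\<in>I - {i0}. c i \<noteq> 0" "\<And>l. l \<in> K \<Longrightarrow> (\<Sum>i\<in>I - {i0}. c i * M' i l) = 0" by blast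
    define c' where "c' i = (if i = i0 then - (\<Sum>j\<in>I - {i0}. c j * (M j k / M i0 k)) else c i)" for i
    have sum_c': "(\<Sum>i\<in>I. c' i * M i l) = (\<Sum>i\<in>I - {i0}. c i * M' i l)" for l
    proof -
      have "(\<Sum>i\<in>I. c' i * M i l) = c' i0 * M i0 l + (\<Sum>i\<in>I - {i0}. c' i * M i l)"
        by (rule sum.remove[OF insert.prems(1) i0(1)])
      also have "(\<Sum>i\<in>I - {i0}. c' i * M i l) = (\<Sum>i\<in>I - {i0}. c i * M i l)"
        by (rule sum.cong) (auto simp: c'_def)
      also have "c' i0 * M i0 l = - (\<Sum>j\<in>I - {i0}. c j * (M j k / M i0 k) * M i0 l)"
        by (simp add: c'_def sum_distrib_right)
      finally show ?thesis unfolding M'_def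
        by (simp add: right_diff_distrib sum_subtractf mult.assoc)
    qed
    have "(\<Sum>i\<in>I. c' i * M i l) = 0" if "l \<in> insert k K" for l
    proof (cases "l = k")
      case True
      then show ?thesis unfolding sum_c' M'_def using i0(2) by simp
    next
      case False
      then show ?thesis unfolding sum_c' using c(2) that by simp
    qed
    moreover have "\<exists>i\<in>I. c' i \<noteq> 0" using c(1) by (auto simp: c'_def)
    ultimately show ?thesis by blast
  qed
qed

text \<open>Exponents of monomials of equal degree in the two groups of variables: those invariant under
  \<open>x \<mapsto> \<lambda>x\<close>, \<open>y \<mapsto> \<lambda>\<^bsup>-1\<^esup>y\<close>. This one-dimensional symmetry of the parametrisation is why the
  dimension is one less than the number of parameters.\<close>

definition balanced :: "nat \<Rightarrow> (('a::finite \<Rightarrow> nat) \<times> ('a \<Rightarrow> nat)) set" where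
  "balanced D = {k. (\<forall>a. fst k a \<le> D \<and> snd k a \<le> D) \<and> (\<Sum>a\<in>UNIV. fst k a) = (\<Sum>a\<in>UNIV. snd k a)}"

lemma finite_balanced: "finite (balanced D :: (('a::finite \<Rightarrow> nat) \<times> ('a \<Rightarrow> nat)) set)"
  and card_balanced: "card (balanced D :: (('a \<Rightarrow> nat) \<times> ('a \<Rightarrow> nat)) set) \<le> Suc D ^ (2 * CARD('a) - 1)"
proof -
  \<comment> \<open>An arbitrary vertex: the balance condition determines its exponent in the second group.\<close>
  define a0 :: 'a where "a0 = undefined"
  define T where "T = PiE (UNIV :: 'a set) (\<lambda>_. {..D}) \<times> PiE (UNIV - {a0}) (\<lambda>_. {..D})"
  define g where "g k = (fst k, restrict (snd k) (UNIV - {a0}))" for k :: "('a \<Rightarrow> nat) \<times> ('a \<Rightarrow> nat)"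
  have finT: "finite T" unfolding T_def by (intro finite_cartesian_product finite_PiE) auto
  have "inj_on g (balanced D)"
  proof (rule inj_onI)
    fix k l :: "('a \<Rightarrow> nat) \<times> ('a \<Rightarrow> nat)"
    assume k: "k \<in> balanced D" and l: "l \<in> balanced D" and eq: "g k = g l"
    have f: "fst k = fst l" using eq by (simp add: g_def)
    have r: "restrict (snd k) (UNIV - {a0}) = restrict (snd l) (UNIV - {a0})" using eq by (simp add: g_def)
    have s: "snd k a = snd l a" if "a \<noteq> a0" for a using fun_cong[OF r, of a] that by simp
    have rem: "(\<Sum>a\<in>UNIV. h a) = h a0 + (\<Sum>a\<in>UNIV - {a0}. h a)" for h :: "'a \<Rightarrow> nat"
      by (rule sum.remove) auto
    have "(\<Sum>a\<in>UNIV. snd k a) = (\<Sum>a\<in>UNIV. snd l a)" using k l f by (simp add: balanced_def)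
    moreover have "(\<Sum>a\<in>UNIV - {a0}. snd k a) = (\<Sum>a\<in>UNIV - {a0}. snd l a)"
      by (rule sum.cong) (use s in auto)
    ultimately have "snd k a0 = snd l a0" unfolding rem by linarith
    then have "snd k a = snd l a" for a using s[of a] by (cases "a = a0") simp_all
    then have "snd k = snd l" by (rule ext)
    with f show "k = l" by (rule prod_eqI)
  qed
  moreover have "g ` balanced D \<subseteq> T"
    unfolding g_def T_def balanced_def by (auto simp: PiE_def Pi_def)
  ultimately have "finite (balanced D :: (('a \<Rightarrow> nat) \<times> ('a \<Rightarrow> nat)) set)"
    and le: "card (balanced D :: (('a \<Rightarrow> nat) \<times> ('a \<Rightarrow> nat)) set) \<le> card T"
    using finT inj_on_finite card_inj_on_le by blast+
  then show "finite (balanced D :: (('a \<Rightarrow> nat) \<times> ('a \<Rightarrow> nat)) set)" by blast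
  have "card T = Suc D ^ CARD('a) * Suc D ^ (CARD('a) - 1)"
    unfolding T_def card_cartesian_product by (simp add: card_PiE card_Diff_singleton)
  also have "\<dots> = Suc D ^ (CARD('a) + (CARD('a) - 1))" by (rule power_add[symmetric])
  also have "CARD('a) + (CARD('a) - 1) = 2 * CARD('a) - 1" using zero_less_card_finite[where 'a = 'a] by simp
  finally show "card (balanced D :: (('a \<Rightarrow> nat) \<times> ('a \<Rightarrow> nat)) set) \<le> Suc D ^ (2 * CARD('a) - 1)" using le by simp
qed

text \<open>Together these spaces form a filtered algebra of functions, which contains all polynomials in
  the coefficients of the network; the following lemmas establish this.\<close>

definition balanced_span :: "nat \<Rightarrow> (('a::finite \<Rightarrow> real) \<times> ('a \<Rightarrow> real) \<Rightarrow> real) set" where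
  "balanced_span D = {h. \<exists>c. \<forall>p. h p = (\<Sum>k\<in>balanced D. c k * toric_char k p)}"

lemma balanced_spanI:
  assumes "\<And>p. h p = (\<Sum>k\<in>balanced D. c k * toric_char k p)"
  shows "h \<in> balanced_span D"
  unfolding balanced_span_def using assms by (intro CollectI exI[of _ c] allI)

lemma balanced_span_mono:
  assumes "D \<le> E" "h \<in> balanced_span D"
  shows "h \<in> balanced_span E"
proof -
  obtain c where c: "\<And>p. h p = (\<Sum>k\<in>balanced D. c k * toric_char k p)"
    using assms(2) unfolding balanced_span_def by blast
  have sub: "balanced D \<subseteq> (balanced E :: (('a \<Rightarrow> nat) \<times> ('a \<Rightarrow> nat)) set)"
    using assms(1) unfolding balanced_def by (auto intro: order_trans)
  have "h p = (\<Sum>k\<in>balanced E. (if k \<in> balanced D then c k else 0) * toric_char k p)" for p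
    unfolding c by (rule sum.mono_neutral_cong_left[OF finite_balanced sub]) auto
  then show ?thesis by (rule balanced_spanI)
qed

lemma balanced_span_add:
  assumes "g \<in> balanced_span D" "h \<in> balanced_span D"
  shows "(\<lambda>p. g p + h p) \<in> balanced_span D"
proof -
  obtain b where b: "\<And>p. g p = (\<Sum>k\<in>balanced D. b k * toric_char k p)"
    using assms(1) unfolding balanced_span_def by blast
  obtain c where c: "\<And>p. h p = (\<Sum>k\<in>balanced D. c k * toric_char k p)"
    using assms(2) unfolding balanced_span_def by blast
  have "g p + h p = (\<Sum>k\<in>balanced D. (b k + c k) * toric_char k p)" for p
    unfolding b c by (simp add: sum.distrib distrib_right)
  then show ?thesis by (rule balanced_spanI)
qed

lemma balanced_span_scale:
  assumes "h \<in> balanced_span D"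
  shows "(\<lambda>p. x * h p) \<in> balanced_span D"
proof -
  obtain c where c: "\<And>p. h p = (\<Sum>k\<in>balanced D. c k * toric_char k p)"
    using assms unfolding balanced_span_def by blast
  have "x * h p = (\<Sum>k\<in>balanced D. (x * c k) * toric_char k p)" for p
    unfolding c by (simp add: sum_distrib_left mult.assoc)
  then show ?thesis by (rule balanced_spanI)
qed

lemma toric_char_in_balanced_span:
  assumes "k \<in> balanced D"
  shows "toric_char k \<in> balanced_span D"
proof -
  have "toric_char k p = (\<Sum>l\<in>balanced D. (if l = k then 1 else 0) * toric_char l p)" for p
    using assms by (simp add: finite_balanced if_distrib[of "\<lambda>x. x * _"] cong: if_cong)
  then show ?thesis by (rule balanced_spanI)
qed

lemma balanced_span_sum:
  assumes "\<And>i. i \<in> I \<Longrightarrow> g i \<in> balanced_span D"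
  shows "(\<lambda>p. \<Sum>i\<in>I. g i p) \<in> balanced_span D"
proof -
  have zero: "(\<lambda>p. 0) \<in> balanced_span D"
    by (rule balanced_spanI[where c = "\<lambda>_. 0"]) simp
  show ?thesis using assms
  proof (induction I rule: infinite_finite_induct)
    case (insert i I)
    then show ?case using balanced_span_add[of "g i" D "\<lambda>p. \<Sum>i\<in>I. g i p"] by simp
  qed (use zero in simp_all)
qed

lemma toric_char_mult:
  "toric_char k p * toric_char l p = toric_char (\<lambda>a. fst k a + fst l a, \<lambda>a. snd k a + snd l a) p"
  by (simp add: toric_char_def power_add prod.distrib)

lemma balanced_span_mult:
  assumes "g \<in> balanced_span D" "h \<in> balanced_span E"
  shows "(\<lambda>p. g p * h p) \<in> balanced_span (D + E)"
proof -
  obtain b where b: "\<And>p. g p = (\<Sum>k\<in>balanced D. b k * toric_char k p)"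
    using assms(1) unfolding balanced_span_def by blast
  obtain c where c: "\<And>p. h p = (\<Sum>k\<in>balanced E. c k * toric_char k p)"
    using assms(2) unfolding balanced_span_def by blast
  have eq: "g p * h p = (\<Sum>k\<in>balanced D. \<Sum>l\<in>balanced E.
      (b k * c l) * toric_char (\<lambda>a. fst k a + fst l a, \<lambda>a. snd k a + snd l a) p)" for p
    unfolding b c sum_product toric_char_mult[symmetric] by (simp only: ac_simps)
  show ?thesis unfolding eq
  proof (intro balanced_span_sum balanced_span_scale toric_char_in_balanced_span)
    fix k l :: "('a \<Rightarrow> nat) \<times> ('a \<Rightarrow> nat)"
    assume "k \<in> balanced D" "l \<in> balanced E"
    then show "(\<lambda>a. fst k a + fst l a, \<lambda>a. snd k a + snd l a) \<in> balanced (D + E)"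
      by (auto simp: balanced_def sum.distrib intro: add_mono)
  qed
qed

lemma balanced_span_const: "(\<lambda>p. x) \<in> balanced_span D"
proof -
  have "toric_char (\<lambda>_. 0, \<lambda>_. 0) \<in> balanced_span D"
    by (rule toric_char_in_balanced_span) (simp add: balanced_def)
  then have "(\<lambda>p. x * toric_char (\<lambda>_. 0, \<lambda>_. 0) p) \<in> balanced_span D"
    by (rule balanced_span_scale)
  then show ?thesis by (simp add: toric_char_def)
qed

lemma balanced_span_power:
  assumes "g \<in> balanced_span D"
  shows "(\<lambda>p. g p ^ e) \<in> balanced_span (D * e)"
proof (induction e)
  case 0
  show ?case using balanced_span_const by simp
next
  case (Suc e)
  show ?case using balanced_span_mult[OF assms Suc.IH] by simp
qed

lemma net_in_balanced_span:
  fixes v :: "('m::finite, 'n::finite) coeff_var"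
  shows "(\<lambda>p. net (fst p) (snd p) v) \<in> balanced_span 1"
proof -
  obtain i c where v: "v = edge i c" using edge_surj[of v] by blast
  have char: "toric_char (\<lambda>x. of_bool (x = a), \<lambda>x. of_bool (x = b)) p = fst p a * snd p b" for a b p
    unfolding toric_char_def fst_conv snd_conv prod_unit_powers ..
  have mem: "(\<lambda>p. fst p a * snd p b) \<in> balanced_span 1" for a b :: "'n + 'm"
    unfolding char[symmetric] by (rule toric_char_in_balanced_span) (simp add: balanced_def)
  have eq: "net (fst p) (snd p) v = 1 / entry_coeff i c * (fst p (Inl i) * snd p c + fst p c * snd p (Inl i))" for p
    unfolding v net_edge by (simp add: mult.commute)
  show ?thesis unfolding eq by (intro balanced_span_scale balanced_span_add mem)
qed

lemma eval_monom_in_balanced_span: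
  "\<exists>D. (\<lambda>p. eval_monom (net (fst p) (snd p)) t) \<in> balanced_span D"
proof -
  have "\<exists>D. (\<lambda>p. \<Prod>v\<in>A. net (fst p) (snd p) v ^ Poly_Mapping.lookup t v) \<in> balanced_span D" if "finite A" for A
    using that
  proof (induction A rule: finite_induct)
    case empty
    show ?case using balanced_span_const[of 1] by auto
  next
    case (insert v A)
    then obtain D where "(\<lambda>p. \<Prod>v\<in>A. net (fst p) (snd p) v ^ Poly_Mapping.lookup t v) \<in> balanced_span D" by blast
    from balanced_span_mult[OF balanced_span_power[OF net_in_balanced_span] this] show ?case
      unfolding prod.insert[OF insert.hyps] by blast
  qed
  from this[OF finite_keys] show ?thesis unfolding eval_monom_def by blast
qed

lemma peval_in_balanced_span:
  "\<exists>D. (\<lambda>p. peval (net (fst p) (snd p)) f) \<in> balanced_span D"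
proof -
  have "\<exists>D. \<forall>t\<in>A. (\<lambda>p. eval_monom (net (fst p) (snd p)) t) \<in> balanced_span D" if "finite A" for A
    using that
  proof (induction A rule: finite_induct)
    case (insert t A)
    then obtain D where D: "\<forall>t\<in>A. (\<lambda>p. eval_monom (net (fst p) (snd p)) t) \<in> balanced_span D" by blast
    obtain E where "(\<lambda>p. eval_monom (net (fst p) (snd p)) t) \<in> balanced_span E"
      using eval_monom_in_balanced_span by blast
    then have "\<forall>t\<in>insert t A. (\<lambda>p. eval_monom (net (fst p) (snd p)) t) \<in> balanced_span (max D E)"
      using D balanced_span_mono[of D "max D E"] balanced_span_mono[of E "max D E"] by auto
    then show ?case by blast
  qed simp
  from this[OF finite_keys] obtain D
    where "\<forall>t\<in>Poly_Mapping.keys f. (\<lambda>p. eval_monom (net (fst p) (snd p)) t) \<in> balanced_span D" by blast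
  then have "(\<lambda>p. peval (net (fst p) (snd p)) f) \<in> balanced_span D"
    unfolding peval_eq by (intro balanced_span_sum balanced_span_scale) blast
  then show ?thesis by blast
qed

lemma power_product_in_balanced_span:
  assumes "\<And>f. f \<in> set fs \<Longrightarrow> (\<lambda>p. peval (net (fst p) (snd p)) f) \<in> balanced_span D"
    and "es \<in> exponents (length fs) s"
  shows "(\<lambda>p. peval (net (fst p) (snd p)) (power_product fs es)) \<in> balanced_span (D * s * length fs)"
  using assms
proof (induction fs arbitrary: es)
  case Nil
  then show ?case using balanced_span_const by simp
next
  case (Cons f fs)
  then obtain e es' where es: "es = e # es'" "e \<le> s" "es' \<in> exponents (length fs) s"
    unfolding length_Cons exponents_Suc by auto
  have "(\<lambda>p. peval (net (fst p) (snd p)) f ^ e) \<in> balanced_span (D * e)"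
    by (rule balanced_span_power) (use Cons.prems(1) in simp)
  then have 1: "(\<lambda>p. peval (net (fst p) (snd p)) f ^ e) \<in> balanced_span (D * s)"
    by (rule balanced_span_mono[rotated]) (use es(2) in simp)
  have 2: "(\<lambda>p. peval (net (fst p) (snd p)) (power_product fs es')) \<in> balanced_span (D * s * length fs)"
    by (rule Cons.IH) (use Cons.prems(1) es(3) in simp_all)
  show ?case using balanced_span_mult[OF 1 2] unfolding es(1) by simp
qed

text \<open>With exponents up to \<open>s\<close> there are \<open>(s + 1)\<^sup>k\<close> power products of \<open>k\<close> polynomials. As functions of
  the parameters they lie in a space whose dimension grows like \<open>s\<close> to the power
  \<open>2(n + m) - 1\<close>. If \<open>k\<close> is larger than that, a relation exists for large \<open>s\<close>.\<close>

lemma alg_independent_length: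
  fixes fs :: "('m::finite, 'n::finite) coeff_var rpoly list"
  assumes ind: "alg_independent network_ideal fs"
  shows "length fs \<le> 2 * (CARD('n) + CARD('m)) - 1"
proof (rule ccontr)
  let ?N = "2 * (CARD('n) + CARD('m)) - 1"
  let ?k = "length fs"
  assume "\<not> ?k \<le> ?N"
  then have k: "Suc ?N \<le> ?k" by simp
  have "\<exists>D. \<forall>f\<in>set gs. (\<lambda>p. peval (net (fst p) (snd p)) f) \<in> balanced_span D"
    for gs :: "('m, 'n) coeff_var rpoly list"
  proof (induction gs)
    case (Cons g gs)
    then obtain D where D: "\<forall>f\<in>set gs. (\<lambda>p. peval (net (fst p) (snd p)) f) \<in> balanced_span D" by blast
    obtain E where "(\<lambda>p. peval (net (fst p) (snd p)) g) \<in> balanced_span E"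
      using peval_in_balanced_span by blast
    then have "\<forall>f\<in>set (g # gs). (\<lambda>p. peval (net (fst p) (snd p)) f) \<in> balanced_span (max D E)"
      using D balanced_span_mono[of D "max D E"] balanced_span_mono[of E "max D E"] by auto
    then show ?case by blast
  qed simp
  then obtain D where D: "\<And>f. f \<in> set fs \<Longrightarrow> (\<lambda>p. peval (net (fst p) (snd p)) f) \<in> balanced_span D" by blast
  \<comment> \<open>Large enough to beat the constant in \<open>(D k s + 1)\<^sup>N \<le> (D k + 1)\<^sup>N (s + 1)\<^sup>N\<close>.\<close>
  define s where "s = Suc (D * ?k) ^ ?N"
  let ?K = "balanced (D * s * ?k) :: (('n + 'm \<Rightarrow> nat) \<times> ('n + 'm \<Rightarrow> nat)) set"
  have "card ?K \<le> Suc (D * s * ?k) ^ ?N"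
    using card_balanced[where 'a = "'n + 'm", of "D * s * ?k"] by (simp add: card_UNIV_sum)
  also have "\<dots> \<le> (Suc (D * ?k) * Suc s) ^ ?N"
    by (rule power_mono) (simp_all add: algebra_simps)
  also have "\<dots> = s * Suc s ^ ?N" by (simp only: power_mult_distrib s_def)
  also have "\<dots> < Suc s * Suc s ^ ?N" by simp
  also have "\<dots> = Suc s ^ Suc ?N" by (simp only: power_Suc)
  also have "\<dots> \<le> Suc s ^ ?k" by (rule power_increasing[OF k]) simp
  finally have card_less: "card ?K < card (exponents ?k s)" by (simp only: card_exponents)
  have "\<exists>M. \<forall>p. peval (net (fst p) (snd p)) (power_product fs es) = (\<Sum>k\<in>?K. M k * toric_char k p)"
    if "es \<in> exponents ?k s" for es
    using power_product_in_balanced_span[OF D that] by (simp only: balanced_span_def mem_Collect_eq)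
  then have "\<exists>M. \<forall>es\<in>exponents ?k s. \<forall>p.
      peval (net (fst p) (snd p)) (power_product fs es) = (\<Sum>k\<in>?K. M es k * toric_char k p)"
    by (intro bchoice ballI)
  then obtain M where "\<forall>es\<in>exponents ?k s. \<forall>p.
      peval (net (fst p) (snd p)) (power_product fs es) = (\<Sum>k\<in>?K. M es k * toric_char k p)"
    by (rule exE)
  then have M: "peval (net (fst p) (snd p)) (power_product fs es) = (\<Sum>k\<in>?K. M es k * toric_char k p)"
    if "es \<in> exponents ?k s" for es p using that by simp
  obtain c where c: "\<exists>es\<in>exponents ?k s. c es \<noteq> 0" "\<And>k. k \<in> ?K \<Longrightarrow> (\<Sum>es\<in>exponents ?k s. c es * M es k) = 0"
    using nontrivial_relation[OF finite_balanced finite_exponents card_less, of M] by blast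
  have "peval (net x y) (alg_combination fs s c) = 0" for x y
  proof -
    have "peval (net x y) (alg_combination fs s c)
        = (\<Sum>es\<in>exponents ?k s. c es * (\<Sum>k\<in>?K. M es k * toric_char k (x, y)))"
      unfolding alg_combination_def using M[of _ "(x, y)"] by simp
    also have "\<dots> = (\<Sum>k\<in>?K. \<Sum>es\<in>exponents ?k s. c es * (M es k * toric_char k (x, y)))"
      unfolding sum_distrib_left by (rule sum.swap)
    also have "\<dots> = (\<Sum>k\<in>?K. (\<Sum>es\<in>exponents ?k s. c es * M es k) * toric_char k (x, y))"
      by (simp only: sum_distrib_right mult.assoc)
    also have "\<dots> = 0" using c(2) by simp
    finally show ?thesis .
  qed
  then have "alg_combination fs s c \<in> network_ideal" by (simp add: network_ideal_eq)
  then show False using ind c(1) unfolding alg_independent_def by blast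
qed

section \<open>A chain of full length\<close>

text \<open>Polynomial functions of one variable, for restricting polynomials to lines in parameter space.\<close>

definition poly_fun :: "(real \<Rightarrow> real) \<Rightarrow> bool" where
  "poly_fun h \<longleftrightarrow> (\<exists>a. \<forall>t. h t = poly a t)"

lemma poly_fun_const: "poly_fun (\<lambda>t. c)"
  unfolding poly_fun_def by (intro exI[of _ "[:c:]"]) simp

lemma poly_fun_id: "poly_fun (\<lambda>t. t)"
  unfolding poly_fun_def by (intro exI[of _ "[:0, 1:]"]) simp

lemma poly_fun_add:
  assumes "poly_fun g" "poly_fun h" shows "poly_fun (\<lambda>t. g t + h t)"
proof -
  obtain a b where "\<And>t. g t = poly a t" "\<And>t. h t = poly b t" using assms unfolding poly_fun_def by blast
  then show ?thesis unfolding poly_fun_def by (intro exI[of _ "a + b"]) simp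
qed

lemma poly_fun_mult:
  assumes "poly_fun g" "poly_fun h" shows "poly_fun (\<lambda>t. g t * h t)"
proof -
  obtain a b where "\<And>t. g t = poly a t" "\<And>t. h t = poly b t" using assms unfolding poly_fun_def by blast
  then show ?thesis unfolding poly_fun_def by (intro exI[of _ "a * b"]) simp
qed

lemma poly_fun_power:
  assumes "poly_fun g" shows "poly_fun (\<lambda>t. g t ^ e)"
  by (induction e) (auto intro: poly_fun_const poly_fun_mult[OF assms])

lemma poly_fun_sum:
  assumes "\<And>i. i \<in> I \<Longrightarrow> poly_fun (g i)" shows "poly_fun (\<lambda>t. \<Sum>i\<in>I. g i t)"
  using assms by (induction I rule: infinite_finite_induct) (auto intro: poly_fun_const poly_fun_add)

lemma poly_fun_prod:
  assumes "\<And>i. i \<in> I \<Longrightarrow> poly_fun (g i)" shows "poly_fun (\<lambda>t. \<Prod>i\<in>I. g i t)"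
  using assms by (induction I rule: infinite_finite_induct) (auto intro: poly_fun_const poly_fun_mult)

lemma poly_fun_peval:
  assumes "\<And>v. poly_fun (\<lambda>t. z t v)"
  shows "poly_fun (\<lambda>t. peval (z t) f)"
  unfolding peval_def
  by (intro poly_fun_sum poly_fun_mult poly_fun_prod poly_fun_power poly_fun_const assms)

lemma poly_fun_no_zero_divisors:
  assumes "poly_fun g" "poly_fun h" "\<And>t. g t * h t = 0"
  shows "(\<forall>t. g t = 0) \<or> (\<forall>t. h t = 0)"
proof -
  obtain a b where ab: "\<And>t. g t = poly a t" "\<And>t. h t = poly b t" using assms unfolding poly_fun_def by blast
  have "\<forall>t. poly (a * b) t = 0" using assms(3) by (simp add: ab)
  then have "a * b = 0" using poly_all_0_iff_0 by blast
  then show ?thesis using ab by auto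
qed

text \<open>The polynomials that vanish on the image of a coordinate subspace of the parameter space: the
  parameters in \<open>K\<close> are set to zero, where \<open>(a, True)\<close> stands for \<open>x\<^sub>a\<close> and \<open>(a, False)\<close> for \<open>y\<^sub>a\<close>.\<close>

definition coordinate_ideal :: "(('n::finite + 'm::finite) \<times> bool) set \<Rightarrow> ('m, 'n) coeff_var rpoly set" where
  "coordinate_ideal K = {f. \<forall>x y. (\<forall>a. (a, True) \<in> K \<longrightarrow> x a = 0) \<longrightarrow> (\<forall>a. (a, False) \<in> K \<longrightarrow> y a = 0)
      \<longrightarrow> peval (net x y) f = 0}"

lemma coordinate_idealI:
  assumes "\<And>x y. (\<And>a. (a, True) \<in> K \<Longrightarrow> x a = 0) \<Longrightarrow> (\<And>a. (a, False) \<in> K \<Longrightarrow> y a = 0) \<Longrightarrow> peval (net x y) f = 0"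
  shows "f \<in> coordinate_ideal K"
  using assms unfolding coordinate_ideal_def by blast

lemma coordinate_idealD:
  assumes "f \<in> coordinate_ideal K" "\<And>a. (a, True) \<in> K \<Longrightarrow> x a = 0" "\<And>a. (a, False) \<in> K \<Longrightarrow> y a = 0"
  shows "peval (net x y) f = 0"
  using assms unfolding coordinate_ideal_def by blast

lemma network_ideal_subset_coordinate_ideal: "network_ideal \<subseteq> coordinate_ideal K"
  unfolding network_ideal_eq coordinate_ideal_def by blast

lemma coordinate_ideal_mono: "K \<subseteq> L \<Longrightarrow> coordinate_ideal K \<subseteq> coordinate_ideal L"
  unfolding coordinate_ideal_def by blast

text \<open>A linear subspace is irreducible: if \<open>f\<close> and \<open>g\<close> are nonzero at two of its points, then on the
  line through these points both are nonzero polynomials in one variable, and so is their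
  product.\<close>

lemma prime_coordinate_ideal: "prime_poly_ideal (coordinate_ideal (K :: (('n::finite + 'm::finite) \<times> bool) set))"
  unfolding prime_poly_ideal_def
proof (intro conjI allI impI)
  show "poly_ideal (coordinate_ideal K)"
    unfolding poly_ideal_def coordinate_ideal_def by auto
  show "1 \<notin> coordinate_ideal K"
  proof
    assume "1 \<in> coordinate_ideal K"
    from coordinate_idealD[OF this, of "\<lambda>_. 0" "\<lambda>_. 0"] show False by simp
  qed
  fix f g :: "('m, 'n) coeff_var rpoly"
  assume fg: "f * g \<in> coordinate_ideal K"
  show "f \<in> coordinate_ideal K \<or> g \<in> coordinate_ideal K"
  proof (rule disjCI)
    assume "g \<notin> coordinate_ideal K"
    then obtain x' y' where p': "\<And>a. (a, True) \<in> K \<Longrightarrow> x' a = 0" "\<And>a. (a, False) \<in> K \<Longrightarrow> y' a = 0"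
        "peval (net x' y') g \<noteq> 0"
      unfolding coordinate_ideal_def by blast
    show "f \<in> coordinate_ideal K"
    proof (rule coordinate_idealI)
      fix x y :: "'n + 'm \<Rightarrow> real" assume p: "\<And>a. (a, True) \<in> K \<Longrightarrow> x a = 0" "\<And>a. (a, False) \<in> K \<Longrightarrow> y a = 0"
      define z where "z t = net (\<lambda>a. x a + t * (x' a - x a)) (\<lambda>a. y a + t * (y' a - y a))" for t
      have z: "poly_fun (\<lambda>t. z t v)" for v
      proof -
        obtain i c where v: "v = edge i c" using edge_surj[of v] by blast
        show ?thesis unfolding v z_def net_edge divide_inverse
          by (intro poly_fun_mult poly_fun_add poly_fun_const poly_fun_id)
      qed
      have "peval (z t) f * peval (z t) g = 0" for t
      proof -
        have "peval (z t) (f * g) = 0"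
          unfolding z_def by (rule coordinate_idealD[OF fg]) (simp_all add: p p')
        then show ?thesis by simp
      qed
      then have "(\<forall>t. peval (z t) f = 0) \<or> (\<forall>t. peval (z t) g = 0)"
        by (rule poly_fun_no_zero_divisors[OF poly_fun_peval[OF z] poly_fun_peval[OF z]])
      moreover have "z 0 = net x y" "z 1 = net x' y'" by (simp_all add: z_def)
      ultimately show "peval (net x y) f = 0" using p'(3) by metis
    qed
  qed
qed

text \<open>For the part of \<open>S\<close> in the rows and columns \<open>i\<close>, \<open>j\<close> and the corresponding part \<open>c\<close> of the
  \<open>k\<close>-th column of \<open>A\<close>, this is half of \<open>c\<^sup>T adj(S) c\<close>. It vanishes if \<open>c\<close> is proportional to
  \<open>\<ell>\<^sub>1\<close> or to \<open>\<ell>\<^sub>2\<close>. For independent \<open>\<ell>\<^sub>1\<close>, \<open>\<ell>\<^sub>2\<close> it thereby detects whether one of the two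
  weights of the \<open>k\<close>-th output is zero.\<close>

definition isotropy_form :: "'m \<Rightarrow> 'n \<Rightarrow> 'n \<Rightarrow> ('m, 'n) coeff_var rpoly" where
  "isotropy_form k i j = pvar (CNum k i) ^ 2 * pvar (CDen (Upair j j))
     - pvar (CNum k i) * pvar (CNum k j) * pvar (CDen (Upair i j))
     + pvar (CNum k j) ^ 2 * pvar (CDen (Upair i i))"

lemma peval_isotropy_form:
  fixes x y :: "'n::finite + 'm::finite \<Rightarrow> real"
  assumes "i \<noteq> j"
  shows "peval (net x y) (isotropy_form k i j)
    = - (x (Inr k) * y (Inr k) * (x (Inl i) * y (Inl j) - x (Inl j) * y (Inl i)) ^ 2)"
proof -
  have ne: "net x y (CNum k i) = x (Inl i) * y (Inr k) + y (Inl i) * x (Inr k)" for k :: 'm and i :: 'n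
    using net_edge[of x y i "Inr k"] by (simp add: entry_coeff_def)
  have de: "net x y (CDen (Upair i i)) = x (Inl i) * y (Inl i)" for i :: 'n
    using net_edge[of x y i "Inl i"] by (simp add: entry_coeff_def)
  have dd: "net x y (CDen (Upair i j)) = x (Inl i) * y (Inl j) + y (Inl i) * x (Inl j)"
    using net_edge[of x y i "Inl j"] assms by (simp add: entry_coeff_def)
  show ?thesis
    unfolding isotropy_form_def peval_add peval_diff peval_mult peval_power peval_pvar ne de dd
    by (simp add: power2_eq_square algebra_simps)
qed

lemma peval_pvar_edge:
  assumes "c \<noteq> Inl i"
  shows "peval (net x y) (pvar (edge i c)) = x (Inl i) * y c + y (Inl i) * x c"
  using assms by (simp add: net_edge entry_coeff_def)

lemma peval_pvar_loop: "peval (net x y) (pvar (edge i (Inl i))) = x (Inl i) * y (Inl i)"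
  by (simp only: peval_pvar net_edge) (simp add: entry_coeff_def)

text \<open>The parameters \<open>x\<^sub>a\<close>, \<open>y\<^sub>a\<close> are killed for one vertex \<open>a\<close> after the other, first for the
  outputs, then for the inputs, where \<open>i0\<close> comes last. Each step is strict because of a
  polynomial that starts to vanish: for \<open>x\<^sub>a\<close> with \<open>a\<close> an output it is the isotropy form, which
  takes two inputs that are still alive; for \<open>x\<^sub>a\<close> with \<open>a\<close> an input it is the coefficient
  \<open>x\<^sub>a y\<^sub>a\<close> of the loop at \<open>a\<close>; for \<open>y\<^sub>a\<close> with \<open>a \<noteq> i0\<close> it is the coefficient of the edge between
  \<open>i0\<close> and \<open>a\<close>, which equals \<open>x\<^sub>i\<^sub>0 y\<^sub>a\<close> once \<open>x\<^sub>a\<close> is zero. After \<open>x\<^sub>i\<^sub>0\<close> all coefficients are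
  zero, so \<open>y\<^sub>i\<^sub>0\<close> gives no further step.\<close>

lemma prime_chain_exists:
  assumes n: "CARD('n::finite) \<ge> 2"
  shows "\<exists>P. prime_chain (network_ideal :: ('m::finite, 'n) coeff_var rpoly set) (2 * (CARD('n) + CARD('m)) - 1) P"
proof -
  let ?d = "CARD('n) + CARD('m)"
  obtain i0 :: 'n where True by blast
  have "\<exists>j. j \<noteq> i0"
  proof (rule ccontr)
    assume "\<nexists>j. j \<noteq> i0"
    then have "(UNIV :: 'n set) = {i0}" by auto
    then have "CARD('n) = 1" by (metis card.empty card_insert_disjoint finite.emptyI insert_absorb insert_not_empty One_nat_def)
    then show False using n by simp
  qed
  then obtain j0 where j0: "i0 \<noteq> j0" by metis
  obtain ks :: "'m list" where ks: "set ks = UNIV" "distinct ks"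
    using finite_distinct_list[of "UNIV :: 'm set"] by auto
  obtain us :: "'n list" where us: "set us = UNIV - {i0}" "distinct us"
    using finite_distinct_list[of "UNIV - {i0} :: 'n set"] by auto
  define vs :: "('n + 'm) list" where "vs = map Inr ks @ map Inl us @ [Inl i0]"
  have dist: "distinct vs"
    unfolding vs_def using ks(2) us by (auto simp: distinct_map)
  have set_vs: "set vs = UNIV"
  proof -
    have "a \<in> set vs" for a unfolding vs_def using ks(1) us(1) by (cases a) auto
    then show ?thesis by blast
  qed
  have len: "length vs = ?d"
    using distinct_card[OF dist] set_vs by (simp add: card_UNIV_sum)
  have len_ks: "length ks = CARD('m)" using distinct_card[OF ks(2)] ks(1) by simp
  \<comment> \<open>The parameter killed in step \<open>j\<close> belongs to the vertex \<open>vs ! (j div 2)\<close>, and \<open>x\<close> precedes \<open>y\<close>.\<close>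
  define K where "K i = {(vs ! (j div 2), even j) | j. j < i}" for i
  have K_Suc: "K (Suc i) = insert (vs ! (i div 2), even i) (K i)" for i
    unfolding K_def by (auto simp: less_Suc_eq)
  have index: "l = l'" if "vs ! l = vs ! l'" "l < ?d" "l' < ?d" for l l'
    using that dist len by (simp add: nth_eq_iff_index_eq)
  have K_bound: "2 * l < i \<and> (\<not> b \<longrightarrow> 2 * l + 1 < i)"
    if mem: "(vs ! l, b) \<in> K i" and l: "l < ?d" "i \<le> 2 * ?d" for l i b
  proof -
    from mem obtain j where j: "vs ! l = vs ! (j div 2)" "b = even j" "j < i" unfolding K_def by auto
    have "j div 2 < ?d" by (rule less_mult_imp_div_less) (use j(3) l(2) in linarith)
    then have "l = j div 2" by (rule index[OF j(1) l(1)])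
    then show ?thesis using j(2,3) by simp
  qed
  have pos: "\<exists>l<?d. vs ! l = a" for a using set_vs len by (metis UNIV_I in_set_conv_nth)
  have vs_V: "vs ! l = Inr (ks ! l)" if "l < length ks" for l
    unfolding vs_def using that by (simp add: nth_append)
  have vs_U: "\<exists>i. vs ! l = Inl i" if "l \<ge> length ks" "l < ?d" for l
  proof -
    have "vs ! l = (map Inl us @ [Inl i0]) ! (l - length ks)"
      unfolding vs_def using that by (simp add: nth_append)
    moreover have "(map Inl us @ [Inl i0]) ! (l - length ks) \<in> set (map Inl us @ [Inl i0])"
      by (rule nth_mem) (use that len in \<open>simp add: vs_def\<close>)
    ultimately show ?thesis by auto
  qed
  have last: "vs ! (?d - 1) = Inl i0"
  proof -
    have "vs = (map Inr ks @ map Inl us) @ [Inl i0]" by (simp add: vs_def)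
    moreover from this have "?d - 1 = length (map Inr ks @ map Inl us)" using len by simp
    ultimately show ?thesis by (metis nth_append_length)
  qed
  have i0_free: "(Inl i0, b) \<notin> K i" if "i < 2 * ?d - 1" for i b
  proof
    have d: "?d - 1 < ?d" using zero_less_card_finite[where 'a = 'n] by simp
    assume "(Inl i0, b) \<in> K i"
    then have "2 * (?d - 1) < i" using K_bound[of "?d - 1" b i] d that unfolding last by linarith
    then show False using that d by arith
  qed
  have step: "coordinate_ideal (K i) \<subset> (coordinate_ideal (K (Suc i)) :: ('m, 'n) coeff_var rpoly set)"
    if i: "i < 2 * ?d - 1" for i
  proof -
    define l where "l = i div 2"
    have l: "l < ?d" using i by (simp add: l_def)
    have free: "(vs ! l', b) \<notin> K i" if "l \<le> l'" "l' < ?d" "even i \<or> l < l' \<or> \<not> b" for l' b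
    proof
      assume "(vs ! l', b) \<in> K i"
      then have *: "2 * l' < i" "\<not> b \<longrightarrow> 2 * l' + 1 < i"
        using K_bound[of l' b i] that(2) i by auto
      have "2 * l \<le> i" "i \<le> 2 * l + 1" "even i \<Longrightarrow> i = 2 * l" by (auto simp: l_def)
      then show False using * that by (elim disjE) auto
    qed
    have "\<exists>f :: ('m, 'n) coeff_var rpoly. f \<in> coordinate_ideal (K (Suc i)) \<and> f \<notin> coordinate_ideal (K i)"
    proof (cases "even i")
      case True
      show ?thesis
      proof (cases "l < length ks")
        case True
        let ?k = "ks ! l"
        have vl: "vs ! l = Inr ?k" by (rule vs_V[OF True])
        have U_free: "(Inl j, b) \<notin> K i" for j b
        proof -
          obtain l' where l': "l' < ?d" "vs ! l' = Inl j" using pos by blast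
          have "\<not> l' < length ks" using vs_V l'(2) by auto
          then show ?thesis using free[of l' b] l' True by auto
        qed
        have k_free: "(Inr ?k, b) \<notin> K i" for b using free[of l b] l \<open>even i\<close> vl by auto
        have "isotropy_form ?k i0 j0 \<in> coordinate_ideal (K (Suc i))"
        proof (rule coordinate_idealI)
          fix x y :: "'n + 'm \<Rightarrow> real" assume "\<And>a. (a, True) \<in> K (Suc i) \<Longrightarrow> x a = 0"
          then have "x (Inr ?k) = 0" using \<open>even i\<close> by (simp add: K_Suc l_def[symmetric] vl)
          then show "peval (net x y) (isotropy_form ?k i0 j0) = 0"
            by (simp add: peval_isotropy_form[OF j0])
        qed
        moreover have "isotropy_form ?k i0 j0 \<notin> coordinate_ideal (K i)"
        proof
          \<comment> \<open>Linearly independent \<open>\<ell>\<^sub>1\<close>, \<open>\<ell>\<^sub>2\<close> and both weights of the output nonzero.\<close>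
          let ?x = "\<lambda>a :: 'n + 'm. if a = Inl i0 \<or> a = Inr ?k then 1 else 0 :: real"
          let ?y = "\<lambda>a :: 'n + 'm. if a = Inl j0 \<or> a = Inr ?k then 1 else 0 :: real"
          assume "isotropy_form ?k i0 j0 \<in> coordinate_ideal (K i)"
          then have "peval (net ?x ?y) (isotropy_form ?k i0 j0) = 0"
            by (rule coordinate_idealD) (use U_free k_free in \<open>auto split: if_splits\<close>)
          then show False using j0 by (simp add: peval_isotropy_form[OF j0])
        qed
        ultimately show ?thesis by blast
      next
        case False
        then obtain j where vl: "vs ! l = Inl j" using vs_U[of l] l by auto
        have j_free: "(Inl j, b) \<notin> K i" for b using free[of l b] l \<open>even i\<close> vl by auto
        have "pvar (edge j (Inl j)) \<in> (coordinate_ideal (K (Suc i)) :: ('m, 'n) coeff_var rpoly set)"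
        proof (rule coordinate_idealI)
          fix x y :: "'n + 'm \<Rightarrow> real" assume "\<And>a. (a, True) \<in> K (Suc i) \<Longrightarrow> x a = 0"
          then have "x (Inl j) = 0" using \<open>even i\<close> by (simp add: K_Suc l_def[symmetric] vl)
          then show "peval (net x y) (pvar (edge j (Inl j))) = 0"
            unfolding peval_pvar_loop by simp
        qed
        moreover have "pvar (edge j (Inl j)) \<notin> (coordinate_ideal (K i) :: ('m, 'n) coeff_var rpoly set)"
        proof
          let ?x = "\<lambda>a :: 'n + 'm. if a = Inl j then 1 else 0 :: real"
          assume "pvar (edge j (Inl j)) \<in> (coordinate_ideal (K i) :: ('m, 'n) coeff_var rpoly set)"
          then have "peval (net ?x ?x) (pvar (edge j (Inl j))) = 0"
            by (rule coordinate_idealD) (use j_free in \<open>auto split: if_splits\<close>)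
          then show False unfolding peval_pvar_loop by simp
        qed
        ultimately show ?thesis by blast
      qed
    next
      case False
      let ?v = "vs ! l"
      have vT: "(?v, True) \<in> K i"
        unfolding K_def l_def using False by (intro CollectI exI[of _ "i - 1"]) (auto elim: oddE)
      have v_ne: "?v \<noteq> Inl i0" using vT i0_free[OF i] by auto
      have v_free: "(?v, False) \<notin> K i" using free[of l False] l by auto
      have "pvar (edge i0 ?v) \<in> coordinate_ideal (K (Suc i))"
      proof (rule coordinate_idealI)
        fix x y :: "'n + 'm \<Rightarrow> real" assume x: "\<And>a. (a, True) \<in> K (Suc i) \<Longrightarrow> x a = 0" and y: "\<And>a. (a, False) \<in> K (Suc i) \<Longrightarrow> y a = 0"
        have "x ?v = 0" "y ?v = 0" using x[of ?v] y[of ?v] vT False by (simp_all add: K_Suc l_def)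
        then show "peval (net x y) (pvar (edge i0 ?v)) = 0"
          unfolding peval_pvar_edge[OF v_ne] by simp
      qed
      moreover have "pvar (edge i0 ?v) \<notin> coordinate_ideal (K i)"
      proof
        let ?x = "\<lambda>a :: 'n + 'm. if a = Inl i0 then 1 else 0 :: real"
        let ?y = "\<lambda>a :: 'n + 'm. if a = ?v then 1 else 0 :: real"
        assume "pvar (edge i0 ?v) \<in> coordinate_ideal (K i)"
        then have "peval (net ?x ?y) (pvar (edge i0 ?v)) = 0"
          by (rule coordinate_idealD) (use i0_free[OF i] v_free in \<open>auto split: if_splits\<close>)
        then show False unfolding peval_pvar_edge[OF v_ne] using v_ne by simp
      qed
      ultimately show ?thesis by blast
    qed
    moreover have "coordinate_ideal (K i) \<subseteq> (coordinate_ideal (K (Suc i)) :: ('m, 'n) coeff_var rpoly set)"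
      by (rule coordinate_ideal_mono) (auto simp: K_Suc)
    ultimately show ?thesis by blast
  qed
  have "prime_chain (network_ideal :: ('m, 'n) coeff_var rpoly set) (2 * ?d - 1) (\<lambda>i. coordinate_ideal (K i))"
    unfolding prime_chain_def using prime_coordinate_ideal network_ideal_subset_coordinate_ideal step by blast
  then show ?thesis by blast
qed

theorem krull_dim_network:
  assumes "CARD('n::finite) \<ge> 2"
  shows "krull_dim (rpoly_ring Quot (network_ideal :: ('m::finite, 'n) coeff_var rpoly set))
    = enat (2 * (CARD('n) + CARD('m)) - 1)"
  unfolding krull_dim_Quot_eq[OF poly_ideal_network]
proof (rule antisym)
  show "(SUP k\<in>{k. \<exists>P. prime_chain (network_ideal :: ('m, 'n) coeff_var rpoly set) k P}. enat k)
      \<le> enat (2 * (CARD('n) + CARD('m)) - 1)"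
  proof (rule SUP_least)
    fix k assume "k \<in> {k. \<exists>P. prime_chain (network_ideal :: ('m, 'n) coeff_var rpoly set) k P}"
    then obtain P where P: "prime_chain (network_ideal :: ('m, 'n) coeff_var rpoly set) k P" by blast
    obtain fs where fs: "length fs = k" "alg_independent (P 0) fs"
      using chain_gives_independent[OF P] by blast
    have "network_ideal \<subseteq> P 0" using P unfolding prime_chain_def by blast
    from alg_independent_length[OF alg_independent_antimono[OF this fs(2)]]
    show "enat k \<le> enat (2 * (CARD('n) + CARD('m)) - 1)" using fs(1) by simp
  qed
  show "enat (2 * (CARD('n) + CARD('m)) - 1)
      \<le> (SUP k\<in>{k. \<exists>P. prime_chain (network_ideal :: ('m, 'n) coeff_var rpoly set) k P}. enat k)"
    using prime_chain_exists[OF assms] by (intro SUP_upper) blast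
qed

section \<open>Generators and dimension of the network ideal\<close>

theorem theorem4p5:
  assumes "CARD('n::finite) \<ge> 2"
  shows "(network_ideal :: ('m::finite, 'n) coeff_var rpoly set)
           = genideal rpoly_ring (minors3 coeff_matrix)
         \<and> krull_dim (rpoly_ring Quot (network_ideal :: ('m, 'n) coeff_var rpoly set))
           = enat (2 * (CARD('n) + CARD('m)) - 1)"
  using network_ideal_eq_genideal krull_dim_network[OF assms] by blast

end
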